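(* Let $k\ge1$ and let $(\Lambda,d)$ be a row-finite locally convex $k$-graph. Fix $v\in\widetilde{\Lambda}^0$ and $m\ne n\in\mathbb N^k$. Then $\widetilde{\Lambda}$ has local periodicity $m,n$ at $v$ if and only if $\Lambda$ has local periodicity $m,n$ at $\pi(v)$. In particular, $\widetilde{\Lambda}$ has no local periodicity if and only if $\Lambda$ has no local periodicity.
   Context: **Conventions.** $\mathbb N=\{0,1,2,\dots\}$. $\mathbb N^k$ is an additive monoid with canonical generators $e_1,\dots,e_k$ and coordinatewise order $\le$; $m\wedge n$ and $m\vee n$ are coordinatewise minimum and maximum, also used for elements of $(\mathbb N\cup\{\infty\})^k$; $\infty-n=\infty$ for $n \in \mathbb N$. The operations $\wedge,\vee$ bind more tightly than $+,-$. **$k$-graphs.** A $k$-graph is a countable small category $\Lambda$ with a functor $d:\Lambda\to\mathbb N^k$ ($\mathbb N^k$ viewed as a one-object category under addition), called the degree, with the factorisation property: if $\lambda\in\Lambda$ is a morphism and $d(\lambda)=m+n$, there are unique $\mu,\nu\in\Lambda$ with $d(\mu)=m$, $d(\nu)=n$ and $\lambda=\mu\nu$. Elements of $\Lambda$ are its morphisms (paths); objects are identified with identity morphisms, and the set of these is $\Lambda^0=d^{-1}(0)$ (vertices). $r(\lambda)$ and $s(\lambda)$ denote the codomain and domain of $\lambda$; $\lambda\mu=\lambda\circ\mu$ is defined when $s(\lambda)=r(\mu)$. $\Lambda^n=d^{-1}(n)$. For $E\subseteq\Lambda$ and $v\in\Lambda^0$, $vE=\{\lambda\in E:r(\lambda)=v\}$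 and $Ev=\{\lambda\in E:s(\lambda)=v\}$. For $0\le m\le n\le d(\lambda)$, $\lambda(m,n)$ is the unique path of degree $n-m$ with $\lambda=\lambda'\lambda(m,n)\lambda'''$, $d(\lambda')=m$. $\Lambda$ is row-finite if $v\Lambda^n$ is finite for all $v\in\Lambda^0$, $n\in\mathbb N^k$, and has no sources if all $v\Lambda^n$ are non-empty. $\Lambda$ is locally convex if for distinct $i,j\in\{1,\dots,k\}$ and $\lambda\in\Lambda^{e_i}$, $\mu\in\Lambda^{e_j}$ with $r(\lambda)=r(\mu)$, the sets $s(\lambda)\Lambda^{e_j}$ and $s(\mu)\Lambda^{e_i}$ are non-empty. **Boundary paths.** For $m\in(\mathbb N\cup\{\infty\})^k$, $\Omega_{k,m}$ is the $k$-graph with objects $\{p\in\mathbb N^k:p\le m\}$, morphisms $\{(p,q):p\le q\le m,\ p,q\in\mathbb N^k\}$ with $r(p,q)=p$, $s(p,q)=q$, $(p,q)(q,t)=(p,t)$, and $d(p,q)=q-p$. A boundary path of $\Lambda$ is a degree-preserving functor $x:\Omega_{k,m}\to\Lambda$ such that for all $p\in\mathbb N^k$ with $p\le m$ and all $i$, $p_i=m_i$ implies $x(p)\Lambda^{e_i}=\emptyset$, where $x(p)=x(p,p)$ is the image of the object $p$. Its degree is $d(x)=m$ and its range is $r(x)=x(0)$. If $m=(\infty,\dots,\infty)$, $x$ is an infinite path. $\Lambda^{\le\infty}$ is the set of boundary paths and $v\Lambda^{\le\infty}$ the set of those with range $v$. For $n\in\mathbb N^k$, $n\le d(x)$, $\sigma^n(x)$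 is the boundary path of degree $d(x)-n$ given by $\sigma^n(x)(p,q)=x(p+n,q+n)$. For $\lambda\in\Lambda$ with $s(\lambda)=r(x)$, $\lambda x$ is the unique boundary path of degree $d(\lambda)+d(x)$ with $(\lambda x)(0,d(\lambda))=\lambda$ and $\sigma^{d(\lambda)}(\lambda x)=x$. In a $k$-graph with no sources, all boundary paths are infinite paths. **The graph $\widetilde\Lambda$ (Farthing's construction).** Let $V_\Lambda=\{(x;m):x\in\Lambda^{\le\infty},m\in\mathbb N^k\}$ and $P_\Lambda=\{(x;(m,n)):x\in\Lambda^{\le\infty},m\le n\in\mathbb N^k\}$. Put $(x;m)\sim(y;n)$ iff $x(m\wedge d(x))=y(n\wedge d(y))$ and $m-m\wedge d(x)=n-n\wedge d(y)$. Put $(x;(m,n))\approx(y;(p,q))$ iff $x(m\wedge d(x),n\wedge d(x))=y(p\wedge d(y),q\wedge d(y))$, $m-m\wedge d(x)=p-p\wedge d(y)$, and $n-m=q-p$. These are equivalence relations, with classes $[x;m]$ and $[x;(m,n)]$. $\widetilde\Lambda$ is the category with objects $V_\Lambda/{\sim}$, morphisms $P_\Lambda/{\approx}$, range $[x;(m,n)]\mapsto[x;m]$, source $[x;(m,n)]\mapsto[x;n]$, identities $[x;(m,m)]$, composition $[x;(m,n)]\circ[y;(p,q)]=[x(0,n\wedge d(x))\sigma^{p\wedge d(y)}(y);(m,n+q-p)]$ (when $[x;n]=[y;p]$), and degree $[x;(m,n)]\mapsto n-m$. It is a known result of Farthing that $\widetilde\Lambda$ is a row-finite $k$-graph with no sources.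 **The projection $\pi$.** $\pi:\widetilde\Lambda\to\Lambda$ is the well-defined functor $\pi([x;(m,n)])=x(m\wedge d(x),n\wedge d(x))$; on vertices, $\pi([x;m])=x(m\wedge d(x))$. **Local periodicity.** For a row-finite $k$-graph $\Gamma$, $v\in\Gamma^0$ and $m\ne n\in\mathbb N^k$, $\Gamma$ has local periodicity $m,n$ at $v$ if for every $x\in v\Gamma^{\le\infty}$, $m-m\wedge d(x)=n-n\wedge d(x)$ and $\sigma^{m\wedge d(x)}(x)=\sigma^{n\wedge d(x)}(x)$. $\Gamma$ has no local periodicity if it does not have local periodicity $m,n$ at $v$ for any $v\in\Gamma^0$ and any $m\ne n\in\mathbb N^k$. *)

theory Defs
  imports
    "HOL-Library.FuncSet"
    "HOL-Library.Countable_Set"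
    "HOL-Library.Extended_Nat"
    "HOL-Library.Function_Algebras"
begin

text \<open>
  Elements of \<open>\<nat>\<^sup>k\<close> are functions \<open>'k \<Rightarrow> nat\<close> and elements of \<open>(\<nat> \<union> {\<infinity>})\<^sup>k\<close> are functions
  \<open>'k \<Rightarrow> enat\<close>, for a finite (hence nonempty) index type \<open>'k\<close> with \<open>k\<close> elements. Order, sum and
  (truncated) difference are the pointwise ones.
\<close>

type_synonym 'k deg = "'k \<Rightarrow> nat"
type_synonym 'k edeg = "'k \<Rightarrow> enat"

definition unit_deg :: "'k::finite \<Rightarrow> 'k deg" where
  "unit_deg i = (\<lambda>j. if j = i then 1 else 0)"

definition to_edeg :: "'k::finite deg \<Rightarrow> 'k edeg" where
  "to_edeg m = (\<lambda>i. enat (m i))"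

text \<open>The meet of a finite with an extended degree is finite, so \<open>the_enat\<close> is harmless here.\<close>

definition meet :: "'k::finite deg \<Rightarrow> 'k edeg \<Rightarrow> 'k deg" where
  "meet m d = (\<lambda>i. the_enat (min (enat (m i)) (d i)))"


section \<open>\<open>k\<close>-graphs\<close>

text \<open>
  Objects and morphisms are kept apart; \<open>idt\<close> is the embedding by which objects are
  identified with the morphisms of degree \<open>0\<close>. The composite \<open>cmp \<Lambda> f g\<close> is \<open>f \<circ> g\<close>, meaningful
  when \<open>src \<Lambda> f = rng \<Lambda> g\<close>.
\<close>

record ('o, 'm, 'k) graded_cat =
  Obj :: "'o set"
  Mor :: "'m set"
  rng :: "'m \<Rightarrow> 'o"
  src :: "'m \<Rightarrow> 'o"
  idt :: "'o \<Rightarrow> 'm"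
  cmp :: "'m \<Rightarrow> 'm \<Rightarrow> 'm"
  deg :: "'m \<Rightarrow> 'k deg"

locale small_category =
  fixes C :: "('o, 'm, 'k::finite) graded_cat"
  assumes rng_Obj: "f \<in> Mor C \<Longrightarrow> rng C f \<in> Obj C"
    and src_Obj: "f \<in> Mor C \<Longrightarrow> src C f \<in> Obj C"
    and idt_Mor: "v \<in> Obj C \<Longrightarrow> idt C v \<in> Mor C"
    and rng_idt: "v \<in> Obj C \<Longrightarrow> rng C (idt C v) = v"
    and src_idt: "v \<in> Obj C \<Longrightarrow> src C (idt C v) = v"
    and cmp_Mor: "\<lbrakk>f \<in> Mor C; g \<in> Mor C; src C f = rng C g\<rbrakk> \<Longrightarrow> cmp C f g \<in> Mor C"
    and rng_cmp: "\<lbrakk>f \<in> Mor C; g \<in> Mor C; src C f = rng C g\<rbrakk> \<Longrightarrow> rng C (cmp C f g) = rng C f"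
    and src_cmp: "\<lbrakk>f \<in> Mor C; g \<in> Mor C; src C f = rng C g\<rbrakk> \<Longrightarrow> src C (cmp C f g) = src C g"
    and idt_cmp: "f \<in> Mor C \<Longrightarrow> cmp C (idt C (rng C f)) f = f"
    and cmp_idt: "f \<in> Mor C \<Longrightarrow> cmp C f (idt C (src C f)) = f"
    and cmp_assoc: "\<lbrakk>f \<in> Mor C; g \<in> Mor C; h \<in> Mor C; src C f = rng C g; src C g = rng C h\<rbrakk>
        \<Longrightarrow> cmp C (cmp C f g) h = cmp C f (cmp C g h)"

locale k_graph = small_category \<Lambda> for \<Lambda> :: "('o, 'm, 'k::finite) graded_cat" +
  assumes countable_Obj: "countable (Obj \<Lambda>)"
    and countable_Mor: "countable (Mor \<Lambda>)"
    and deg_idt: "v \<in> Obj \<Lambda> \<Longrightarrow> deg \<Lambda> (idt \<Lambda> v) = 0"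
    and deg_cmp: "\<lbrakk>f \<in> Mor \<Lambda>; g \<in> Mor \<Lambda>; src \<Lambda> f = rng \<Lambda> g\<rbrakk>
        \<Longrightarrow> deg \<Lambda> (cmp \<Lambda> f g) = deg \<Lambda> f + deg \<Lambda> g"
    and factorisation: "\<lbrakk>f \<in> Mor \<Lambda>; deg \<Lambda> f = m + n\<rbrakk>
        \<Longrightarrow> \<exists>!p. case p of (g, h) \<Rightarrow> g \<in> Mor \<Lambda> \<and> h \<in> Mor \<Lambda> \<and> deg \<Lambda> g = m \<and> deg \<Lambda> h = n
                   \<and> src \<Lambda> g = rng \<Lambda> h \<and> f = cmp \<Lambda> g h"

text \<open>\<open>paths_of \<Lambda> v n\<close> is the set \<open>v\<Lambda>\<^sup>n\<close>.\<close>

definition paths_of :: "('o, 'm, 'k::finite) graded_cat \<Rightarrow> 'o \<Rightarrow> 'k deg \<Rightarrow> 'm set" where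
  "paths_of \<Lambda> v n = {f \<in> Mor \<Lambda>. rng \<Lambda> f = v \<and> deg \<Lambda> f = n}"

definition row_finite :: "('o, 'm, 'k::finite) graded_cat \<Rightarrow> bool" where
  "row_finite \<Lambda> \<longleftrightarrow> (\<forall>v \<in> Obj \<Lambda>. \<forall>n. finite (paths_of \<Lambda> v n))"

definition locally_convex :: "('o, 'm, 'k::finite) graded_cat \<Rightarrow> bool" where
  "locally_convex \<Lambda> \<longleftrightarrow>
     (\<forall>i j. i \<noteq> j \<longrightarrow>
       (\<forall>f \<in> Mor \<Lambda>. \<forall>g \<in> Mor \<Lambda>.
          deg \<Lambda> f = unit_deg i \<and> deg \<Lambda> g = unit_deg j \<and> rng \<Lambda> f = rng \<Lambda> g \<longrightarrow>
          paths_of \<Lambda> (src \<Lambda> f) (unit_deg j) \<noteq> {} \<and> paths_of \<Lambda> (src \<Lambda> g) (unit_deg i) \<noteq> {}))"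


section \<open>Boundary paths\<close>

definition degree_functor ::
  "('o, 'm, 'k::finite) graded_cat \<Rightarrow> ('p, 'n, 'k) graded_cat \<Rightarrow> ('o \<Rightarrow> 'p) \<Rightarrow> ('m \<Rightarrow> 'n) \<Rightarrow> bool"
where
  "degree_functor C D F0 F1 \<longleftrightarrow>
     F0 \<in> Obj C \<rightarrow> Obj D \<and> F1 \<in> Mor C \<rightarrow> Mor D \<and>
     (\<forall>f \<in> Mor C. rng D (F1 f) = F0 (rng C f) \<and> src D (F1 f) = F0 (src C f)) \<and>
     (\<forall>v \<in> Obj C. F1 (idt C v) = idt D (F0 v)) \<and>
     (\<forall>f \<in> Mor C. \<forall>g \<in> Mor C. src C f = rng C g \<longrightarrow> F1 (cmp C f g) = cmp D (F1 f) (F1 g)) \<and>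
     (\<forall>f \<in> Mor C. deg D (F1 f) = deg C f)"

definition Omega :: "'k::finite edeg \<Rightarrow> ('k deg, 'k deg \<times> 'k deg, 'k) graded_cat" where
  "Omega m = \<lparr>
     Obj = {p. to_edeg p \<le> m},
     Mor = {(p, q). p \<le> q \<and> to_edeg q \<le> m},
     rng = fst,
     src = snd,
     idt = (\<lambda>p. (p, p)),
     cmp = (\<lambda>f g. (fst f, snd g)),
     deg = (\<lambda>(p, q). q - p) \<rparr>"

text \<open>
  A functor out of \<open>Omega m\<close> together with its degree \<open>m\<close>. Both maps of a boundary path are
  required to be extensional, i.e. \<open>undefined\<close> outside \<open>Omega m\<close>, so that HOL equality of records
  is equality of functors.
\<close>

record ('o, 'm, 'k) path =
  pdeg :: "'k edeg"
  pob :: "'k deg \<Rightarrow> 'o"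
  pmor :: "'k deg \<times> 'k deg \<Rightarrow> 'm"

definition boundary_paths :: "('o, 'm, 'k::finite) graded_cat \<Rightarrow> ('o, 'm, 'k) path set" where
  "boundary_paths \<Lambda> = {x.
     degree_functor (Omega (pdeg x)) \<Lambda> (pob x) (pmor x) \<and>
     pob x \<in> extensional (Obj (Omega (pdeg x))) \<and>
     pmor x \<in> extensional (Mor (Omega (pdeg x))) \<and>
     (\<forall>p i. to_edeg p \<le> pdeg x \<and> enat (p i) = pdeg x i \<longrightarrow>
        paths_of \<Lambda> (pob x p) (unit_deg i) = {})}"

text \<open>\<open>shift n x\<close> is \<open>\<sigma>\<^sup>n(x)\<close>, for \<open>n \<le> d(x)\<close>.\<close>

definition shift :: "'k::finite deg \<Rightarrow> ('o, 'm, 'k) path \<Rightarrow> ('o, 'm, 'k) path" where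
  "shift n x = (let d = pdeg x - to_edeg n in \<lparr>
     pdeg = d,
     pob = restrict (\<lambda>p. pob x (p + n)) (Obj (Omega d)),
     pmor = restrict (\<lambda>(p, q). pmor x (p + n, q + n)) (Mor (Omega d)) \<rparr>)"

text \<open>\<open>prepend \<Lambda> f x\<close> is \<open>fx\<close>, for \<open>s(f) = r(x)\<close>.\<close>

definition prepend ::
  "('o, 'm, 'k::finite) graded_cat \<Rightarrow> 'm \<Rightarrow> ('o, 'm, 'k) path \<Rightarrow> ('o, 'm, 'k) path" where
  "prepend \<Lambda> f x = (THE z. z \<in> boundary_paths \<Lambda> \<and> pdeg z = to_edeg (deg \<Lambda> f) + pdeg x \<and>
     pmor z (0, deg \<Lambda> f) = f \<and> shift (deg \<Lambda> f) z = x)"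


section \<open>Farthing's construction\<close>

definition V_rel ::
  "('o, 'm, 'k::finite) graded_cat
    \<Rightarrow> ((('o, 'm, 'k) path \<times> 'k deg) \<times> (('o, 'm, 'k) path \<times> 'k deg)) set" where
  "V_rel \<Lambda> = {((x, m), (y, n)).
     x \<in> boundary_paths \<Lambda> \<and> y \<in> boundary_paths \<Lambda> \<and>
     pob x (meet m (pdeg x)) = pob y (meet n (pdeg y)) \<and>
     m - meet m (pdeg x) = n - meet n (pdeg y)}"

definition P_rel ::
  "('o, 'm, 'k::finite) graded_cat
    \<Rightarrow> ((('o, 'm, 'k) path \<times> 'k deg \<times> 'k deg) \<times> (('o, 'm, 'k) path \<times> 'k deg \<times> 'k deg)) set"
where
  "P_rel \<Lambda> = {((x, m, n), (y, p, q)).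
     x \<in> boundary_paths \<Lambda> \<and> y \<in> boundary_paths \<Lambda> \<and> m \<le> n \<and> p \<le> q \<and>
     pmor x (meet m (pdeg x), meet n (pdeg x)) = pmor y (meet p (pdeg y), meet q (pdeg y)) \<and>
     m - meet m (pdeg x) = p - meet p (pdeg y) \<and>
     n - m = q - p}"

type_synonym ('o, 'm, 'k) tilde_ob = "(('o, 'm, 'k) path \<times> 'k deg) set"
type_synonym ('o, 'm, 'k) tilde_mor = "(('o, 'm, 'k) path \<times> 'k deg \<times> 'k deg) set"

abbreviation V_class ::
  "('o, 'm, 'k::finite) graded_cat \<Rightarrow> ('o, 'm, 'k) path \<Rightarrow> 'k deg \<Rightarrow> ('o, 'm, 'k) tilde_ob" where
  "V_class \<Lambda> x m \<equiv> V_rel \<Lambda> `` {(x, m)}"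

abbreviation P_class ::
  "('o, 'm, 'k::finite) graded_cat \<Rightarrow> ('o, 'm, 'k) path \<Rightarrow> 'k deg \<Rightarrow> 'k deg
    \<Rightarrow> ('o, 'm, 'k) tilde_mor" where
  "P_class \<Lambda> x m n \<equiv> P_rel \<Lambda> `` {(x, m, n)}"

text \<open>
  Maps on equivalence classes are given by a formula on representatives that does not depend on
  the representative: class-valued ones are the union of the (equal) classes obtained, the others
  are \<open>the_elem\<close> of the (one-element) image.
\<close>

definition tilde ::
  "('o, 'm, 'k::finite) graded_cat
    \<Rightarrow> (('o, 'm, 'k) tilde_ob, ('o, 'm, 'k) tilde_mor, 'k) graded_cat" where
  "tilde \<Lambda> = \<lparr>
     Obj = (boundary_paths \<Lambda> \<times> UNIV) // V_rel \<Lambda>,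
     Mor = (boundary_paths \<Lambda> \<times> {(m, n). m \<le> n}) // P_rel \<Lambda>,
     rng = (\<lambda>a. \<Union>(x, m, n) \<in> a. V_class \<Lambda> x m),
     src = (\<lambda>a. \<Union>(x, m, n) \<in> a. V_class \<Lambda> x n),
     idt = (\<lambda>v. \<Union>(x, m) \<in> v. P_class \<Lambda> x m m),
     cmp = (\<lambda>a b. \<Union>(x, m, n) \<in> a. \<Union>(y, p, q) \<in> b.
       P_class \<Lambda>
         (prepend \<Lambda> (pmor x (0, meet n (pdeg x))) (shift (meet p (pdeg y)) y)) m (n + q - p)),
     deg = (\<lambda>a. the_elem ((\<lambda>(x, m, n). n - m) ` a)) \<rparr>"

text \<open>The object map of the projection \<open>\<pi>\<close>, i.e. \<open>[x;m] \<mapsto> x(m \<and> d(x))\<close>.\<close>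

definition proj_ob :: "('o, 'm, 'k::finite) tilde_ob \<Rightarrow> 'o" where
  "proj_ob v = the_elem ((\<lambda>(x, m). pob x (meet m (pdeg x))) ` v)"


section \<open>Local periodicity\<close>

definition local_periodicity ::
  "('o, 'm, 'k::finite) graded_cat \<Rightarrow> 'k deg \<Rightarrow> 'k deg \<Rightarrow> 'o \<Rightarrow> bool" where
  "local_periodicity \<Gamma> m n v \<longleftrightarrow>
     (\<forall>x \<in> boundary_paths \<Gamma>. pob x 0 = v \<longrightarrow>
        m - meet m (pdeg x) = n - meet n (pdeg x) \<and>
        shift (meet m (pdeg x)) x = shift (meet n (pdeg x)) x)"

definition no_local_periodicity :: "('o, 'm, 'k::finite) graded_cat \<Rightarrow> bool" where
  "no_local_periodicity \<Gamma> \<longleftrightarrow>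
     \<not> (\<exists>v \<in> Obj \<Gamma>. \<exists>m n. m \<noteq> n \<and> local_periodicity \<Gamma> m n v)"

end

theory Submission
  imports Defs
begin

text \<open>
  Boundary paths of \<open>tilde \<Lambda>\<close> are infinite: from \<open>[x; m]\<close> the path \<open>[x; (m, m + e\<^sub>i)]\<close> leads
  on in every direction \<open>i\<close>. Fix a vertex \<open>v = [y; p]\<close> and put \<open>u = proj_ob v\<close> and
  \<open>t = p - p \<and> d(y)\<close>. If \<open>t\<^sub>i > 0\<close>, then \<open>y\<close> has stopped in direction \<open>i\<close> when it reaches \<open>u\<close>, so
  \<open>u\<close> emits no edge of degree \<open>e\<^sub>i\<close> and no boundary path starting at \<open>u\<close> moves in
  direction \<open>i\<close>. It follows that \<open>v = [x; t]\<close> for every boundary path \<open>x\<close> starting at \<open>u\<close>, and that every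
  path starting at \<open>v\<close> has the form \<open>[x; (t, t + l)]\<close> for such an \<open>x\<close> (\<open>tilde_vertex_offset\<close>).

  Each \<open>x\<close> from \<open>u\<close> therefore lifts to an infinite path \<open>(a, b) \<mapsto> [x; (t + a, t + b)]\<close> from \<open>v\<close>. Conversely
  an infinite path \<open>w\<close> from \<open>v\<close> need not be recognised globally as such a lift: the equation
  \<open>\<sigma>\<^sup>m(w) = \<sigma>\<^sup>n(w)\<close> is tested on one segment at a time, every segment lies in some \<open>w(0, l)\<close>, and
  if \<open>w(0, l) = [x; (t, t + l)]\<close> then \<open>w(a, b) = [x; (t + a, t + b)]\<close> for \<open>a \<le> b \<le> l\<close>
  (\<open>tilde_path_segment\<close>). The boundary path \<open>x\<close> may depend on \<open>l\<close>, so no limit has to be taken. Both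
  directions thus come down to one statement about a single \<open>x\<close>, \<open>periodic_iff\<close>: the two conditions in the
  definition of local periodicity for \<open>x\<close> say exactly that
  \<open>[x; (t + m + a, t + m + b)] = [x; (t + n + a, t + n + b)]\<close> whenever \<open>a \<le> b\<close>.

  Splitting \<open>w(0, l)\<close> needs unique factorisation in \<open>tilde \<Lambda>\<close>. This rests on the fact that two
  composable paths have a common representative, \<open>[z; (m, n)]\<close> and \<open>[z; (n, r)]\<close>, in which the
  composite is \<open>[z; (m, r)]\<close> (\<open>prepend_represents_both\<close>, \<open>cmp_tilde\<close>, \<open>split_tilde\<close>). The path \<open>z\<close>
  arises by prepending a path to a boundary path, and local convexity is what makes the result
  a boundary path again (\<open>extension_transfer\<close>, \<open>prepend_ex1\<close>).

  For the statement about all vertices it remains to see that \<open>proj_ob\<close> maps onto \<open>Obj \<Lambda>\<close>, that is,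
  that some boundary path starts at every vertex of \<open>\<Lambda>\<close> (\<open>boundary_path_exists\<close>).
\<close>

section \<open>Degrees\<close>

lemmas pointwise = le_fun_def fun_eq_iff

lemma meet_apply: "meet m d i = (case d i of enat e \<Rightarrow> min (m i) e | \<infinity> \<Rightarrow> m i)"
  by (cases "d i") (auto simp: meet_def min_def)

lemma to_edeg_le_iff: "to_edeg p \<le> d \<longleftrightarrow> (\<forall>i. enat (p i) \<le> d i)"
  by (simp add: to_edeg_def le_fun_def)

lemma to_edeg_le_mono: "p \<le> q \<Longrightarrow> to_edeg q \<le> d \<Longrightarrow> to_edeg p \<le> d"
  unfolding to_edeg_le_iff le_fun_def[of p q] by (meson enat_ord_simps(1) order_trans)

lemma zero_le_deg: "(0 :: 'k \<Rightarrow> nat) \<le> p"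
  by (simp add: pointwise)

lemma to_edeg_zero_le: "to_edeg 0 \<le> d"
  by (simp add: to_edeg_le_iff zero_enat_def[symmetric])

lemma meet_le: "to_edeg (meet m d) \<le> d"
  unfolding to_edeg_le_iff by (auto simp: meet_apply split: enat.split)

lemma meet_absorb: "to_edeg m \<le> d \<Longrightarrow> meet m d = m"
  by (auto simp: fun_eq_iff to_edeg_le_iff meet_apply split: enat.split)
    (metis enat_ord_simps(1) min.absorb1)

lemma meet_le_arg: "meet m d i \<le> m i"
  by (simp add: meet_apply split: enat.split)

lemma meet_mono: "m \<le> n \<Longrightarrow> meet m d \<le> meet n d"
  unfolding le_fun_def by (auto simp: meet_apply min_le_iff_disj split: enat.split)

lemma meet_infinity: "meet m (\<lambda>_. \<infinity>) = m"
  by (simp add: fun_eq_iff meet_apply)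

lemma to_edeg_le_diff_iff:
  assumes "to_edeg n \<le> d"
  shows "to_edeg p \<le> d - to_edeg n \<longleftrightarrow> to_edeg (p + n) \<le> d"
proof -
  have "enat (p i) \<le> (d - to_edeg n) i \<longleftrightarrow> enat ((p + n) i) \<le> d i" for i
    using assms[unfolded to_edeg_le_iff, rule_format, of i] by (cases "d i") (auto simp: to_edeg_def)
  then show ?thesis by (simp add: to_edeg_le_iff)
qed

lemma deg_add_diff: "(p :: 'k \<Rightarrow> nat) \<le> q \<Longrightarrow> p + (q - p) = q"
  by (simp add: pointwise)

lemma deg_diff_add: "(p :: 'k \<Rightarrow> nat) \<le> q \<Longrightarrow> q - p + p = q"
  by (simp add: pointwise)

text \<open>
  A walk of length \<open>l\<close> that is truncated at a bound makes the same truncated steps up to any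
  intermediate time \<open>s\<close> as another one with the same overshoot at the start and the same total step: a walk
  that starts beyond its bound never moves, and otherwise it moves freely until the bound, whose distance
  from the start matters only up to the common total step. This is one coordinate of \<open>meet_diff_cong\<close>.
\<close>

lemma truncate_diff_cong:
  fixes m :: nat
  assumes "s \<le> l" "m - min m D = p - min p E" "min (m + l) D - min m D = min (p + l) E - min p E"
  shows "min (p + s) E - min p E = min (m + s) D - min m D
       \<and> m + s - min (m + s) D = p + s - min (p + s) E"
proof (cases "m \<le> D")
  case True
  then have "p \<le> E" using assms(2) by linarith
  then show ?thesis using assms True
    by (cases "m + l \<le> D"; cases "p + l \<le> E"; cases "m + s \<le> D"; cases "p + s \<le> E"; simp)
next
  case False
  then have "p > E" using assms(2) by linarith
  then show ?thesis using assms False by (simp add: min_def)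
qed

text \<open>
  The degree computation behind passing from \<open>(x; (m, n)) \<approx> (y; (p, q))\<close> to corresponding subsegments,
  with \<open>d\<close> and \<open>e\<close> the degrees of \<open>x\<close> and \<open>y\<close>.
\<close>

lemma meet_diff_cong:
  assumes le: "m \<le> a" "a \<le> n" "p \<le> q" and nq: "n - m = q - p"
    and eq: "m - meet m d = p - meet p e" "meet n d - meet m d = meet q e - meet p e"
  shows "meet (p + (a - m)) e - meet p e = meet a d - meet m d"
    and "a - meet a d = p + (a - m) - meet (p + (a - m)) e"
proof -
  \<comment> \<open>Below \<open>n\<close>, the meet with an infinite coordinate is the meet with \<open>n\<close>.\<close>
  have trunc: "\<exists>D. \<forall>b. b \<le> n \<longrightarrow> meet b d i = min (b i) D"
    for n :: "'a deg" and d :: "'a edeg" and i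
    by (cases "d i") (auto simp: meet_apply le_fun_def intro: exI[of _ "n i"])
  have "meet (p + (a - m)) e i - meet p e i = meet a d i - meet m d i
     \<and> a i - meet a d i = p i + (a i - m i) - meet (p + (a - m)) e i" for i
  proof -
    obtain D where D: "\<And>b. b \<le> n \<Longrightarrow> meet b d i = min (b i) D" using trunc by blast
    obtain E where E: "\<And>b. b \<le> q \<Longrightarrow> meet b e i = min (b i) E" using trunc by blast
    define s where "s = a i - m i"
    define l where "l = n i - m i"
    have le_at: "m j \<le> a j" "a j \<le> n j" "p j \<le> q j" "n j - m j = q j - p j" for j
      using le nq by (simp_all add: pointwise)
    then have i: "a i = m i + s" "n i = m i + l" "q i = p i + l" "s \<le> l"
      using le_at[of i] unfolding s_def l_def by linarith+
    have "p j + (a j - m j) \<le> q j" for j using le_at[of j] by linarith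
    then have "p + (a - m) \<le> q" by (simp add: le_fun_def)
    moreover have "(p + (a - m)) i = p i + s" by (simp add: s_def)
    moreover have "m \<le> n" using le(1,2) by (rule order_trans)
    moreover have "m i - meet m d i = p i - meet p e i"
      "meet n d i - meet m d i = meet q e i - meet p e i"
      using eq by (simp_all add: fun_eq_iff)
    ultimately show ?thesis
      using truncate_diff_cong[OF i(4), of "m i" D "p i" E] i le D E by simp
  qed
  then show "meet (p + (a - m)) e - meet p e = meet a d - meet m d"
    and "a - meet a d = p + (a - m) - meet (p + (a - m)) e"
    by (simp_all add: pointwise)
qed

text \<open>
  Here \<open>D\<close> is the degree of the path that follows one boundary path, of degree \<open>d\<close>, up to \<open>n \<and> d\<close> and then
  another, of degree \<open>e\<close>, from \<open>p \<and> e\<close> on. Equality of the offsets forces each coordinate into one of two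
  cases: both \<open>n\<close> and \<open>p\<close> are within their bounds, or both are strictly beyond, in which case the second
  path contributes nothing. So the joined path looks like the first one before \<open>n\<close> and like the second
  one after it.
\<close>

lemma meet_concat:
  assumes off: "n - meet n d = p - meet p e"
    and D: "D = to_edeg (meet n d) + (e - to_edeg (meet p e))"
  shows "m \<le> n \<Longrightarrow> meet m D = meet m d"
    and "p \<le> q \<Longrightarrow> meet (n + (q - p)) D - meet n d = meet q e - meet p e"
proof -
  have split: "enat (n i) \<le> d i \<and> enat (p i) \<le> e i \<and> D i = enat (n i) + (e i - enat (p i))
      \<or> (\<exists>X Y. d i = enat X \<and> X < n i \<and> e i = enat Y \<and> Y < p i \<and> D i = enat X)" for i
  proof -
    have "n i - meet n d i = p i - meet p e i" using fun_cong[OF off, of i] by simp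
    then show ?thesis
      by (cases "d i"; cases "e i")
        (auto simp: D meet_apply to_edeg_def min_def split: if_splits)
  qed
  show "meet m D = meet m d" if "m \<le> n"
  proof
    fix i
    have "m i \<le> n i" using that by (simp add: le_fun_def)
    then show "meet m D i = meet m d i"
      using split[of i] by (cases "d i"; cases "e i") (auto simp: meet_apply)
  qed
  show "meet (n + (q - p)) D - meet n d = meet q e - meet p e" if "p \<le> q"
  proof
    fix i
    have "p i \<le> q i" using that by (simp add: le_fun_def)
    then show "(meet (n + (q - p)) D - meet n d) i = (meet q e - meet p e) i"
      using split[of i] by (cases "d i"; cases "e i") (auto simp: meet_apply min_def)
  qed
qed

text \<open>
  The hypothesis on \<open>t\<close> is the relation between the offset of a vertex of \<open>tilde \<Lambda>\<close> and the boundary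
  paths that represent it: no movement is possible in the directions in which \<open>t\<close> is positive, so adding
  \<open>t\<close> does not change where the walk stands. With \<open>d - to_edeg (meet m d)\<close> on the right this is the
  degree of the shifted path.
\<close>

lemma meet_add:
  assumes "\<forall>i. t i \<noteq> 0 \<longrightarrow> d i = 0"
  shows "meet (t + (m + a)) d = meet m d + meet a (d - to_edeg (meet m d))"
proof
  fix i
  show "meet (t + (m + a)) d i = (meet m d + meet a (d - to_edeg (meet m d))) i"
    using assms[rule_format, of i]
    by (cases "d i"; cases "m i \<le> the_enat (d i)"; cases "t i = 0")
       (auto simp: meet_apply to_edeg_def zero_enat_def)
qed

lemma offset_add:
  assumes "\<forall>i. t i \<noteq> 0 \<longrightarrow> d i = 0"
  shows "t + (m + a) - meet (t + (m + a)) d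
      = t + (m - meet m d) + (a - meet a (d - to_edeg (meet m d)))"
proof
  fix i
  show "(t + (m + a) - meet (t + (m + a)) d) i
      = (t + (m - meet m d) + (a - meet a (d - to_edeg (meet m d)))) i"
    unfolding meet_add[OF assms]
    using meet_le_arg[of m d i] meet_le_arg[of a "d - to_edeg (meet m d)" i] by simp
qed

lemma edeg_eqI:
  assumes "\<And>a. meet a d = meet a e"
  shows "d = e"
proof
  fix i
  have *: "meet (\<lambda>_. l) d i = meet (\<lambda>_. l) e i" for l using assms by metis
  show "d i = e i"
  proof (cases "d i"; cases "e i")
    fix k l assume "d i = enat k" "e i = enat l"
    then show ?thesis using *[of "k + l"] by (simp add: meet_apply)
  next
    fix k assume "d i = enat k" "e i = \<infinity>"
    then show ?thesis using *[of "Suc k"] by (simp add: meet_apply)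
  next
    fix k assume "d i = \<infinity>" "e i = enat k"
    then show ?thesis using *[of "Suc k"] by (simp add: meet_apply)
  qed simp
qed

lemma ex1_unique: "\<exists>!x. P x \<Longrightarrow> P x \<Longrightarrow> P y \<Longrightarrow> x = y"
  by blast

section \<open>Paths as functors on \<open>Omega\<close>\<close>

text \<open>
  Unpacked for pairs \<open>p \<le> q\<close>, this is the form in which functors on \<open>Omega d\<close> are used and constructed,
  for \<open>\<Lambda>\<close> as well as for \<open>tilde \<Lambda>\<close>.
\<close>

lemma Omega_functor_iff:
  "degree_functor (Omega d) C F0 F1 \<longleftrightarrow>
     (\<forall>p. to_edeg p \<le> d \<longrightarrow> F0 p \<in> Obj C \<and> F1 (p, p) = idt C (F0 p)) \<and>
     (\<forall>p q. p \<le> q \<and> to_edeg q \<le> d \<longrightarrow> F1 (p, q) \<in> Mor C \<and> rng C (F1 (p, q)) = F0 p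
        \<and> src C (F1 (p, q)) = F0 q \<and> deg C (F1 (p, q)) = q - p) \<and>
     (\<forall>p q r. p \<le> q \<and> q \<le> r \<and> to_edeg r \<le> d \<longrightarrow> F1 (p, r) = cmp C (F1 (p, q)) (F1 (q, r)))"
    (is "?L \<longleftrightarrow> ?A \<and> ?B \<and> ?C")
proof -
  have src_le: "to_edeg p \<le> d" if "p \<le> q" "to_edeg q \<le> d" for p q :: "'a deg"
    using that by (rule to_edeg_le_mono)
  show ?thesis
  proof
    assume L: ?L
    show "?A \<and> ?B \<and> ?C"
    proof (intro conjI allI impI; (elim conjE)?)
      fix p :: "'a deg" assume p: "to_edeg p \<le> d"
      then show "F0 p \<in> Obj C" "F1 (p, p) = idt C (F0 p)"
        using L unfolding degree_functor_def Omega_def by auto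
    next
      fix p q :: "'a deg" assume "p \<le> q" "to_edeg q \<le> d"
      then have "(p, q) \<in> Mor (Omega d)" by (simp add: Omega_def)
      then have "F1 (p, q) \<in> Mor C \<and> rng C (F1 (p, q)) = F0 (rng (Omega d) (p, q))
          \<and> src C (F1 (p, q)) = F0 (src (Omega d) (p, q))
          \<and> deg C (F1 (p, q)) = deg (Omega d) (p, q)"
        using L unfolding degree_functor_def by blast
      then show "F1 (p, q) \<in> Mor C" "rng C (F1 (p, q)) = F0 p" "src C (F1 (p, q)) = F0 q"
        "deg C (F1 (p, q)) = q - p"
        by (simp_all add: Omega_def)
    next
      fix p q r :: "'a deg" assume "p \<le> q" "q \<le> r" "to_edeg r \<le> d"
      then have "(p, q) \<in> Mor (Omega d)" "(q, r) \<in> Mor (Omega d)"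
        "src (Omega d) (p, q) = rng (Omega d) (q, r)"
        using src_le by (simp_all add: Omega_def)
      then have "F1 (cmp (Omega d) (p, q) (q, r)) = cmp C (F1 (p, q)) (F1 (q, r))"
        using L unfolding degree_functor_def by blast
      then show "F1 (p, r) = cmp C (F1 (p, q)) (F1 (q, r))" by (simp add: Omega_def)
    qed
  next
    assume R: "?A \<and> ?B \<and> ?C"
    note A = R[THEN conjunct1] and B = R[THEN conjunct2, THEN conjunct1]
      and C = R[THEN conjunct2, THEN conjunct2]
    have mor: "\<exists>p q. f = (p, q) \<and> p \<le> q \<and> to_edeg q \<le> d" if "f \<in> Mor (Omega d)" for f
      using that by (simp add: Omega_def split: prod.splits)
    show ?L
      unfolding degree_functor_def
    proof (intro conjI ballI impI)
      show "F0 \<in> Obj (Omega d) \<rightarrow> Obj C" using A by (simp add: Omega_def)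
      show "F1 \<in> Mor (Omega d) \<rightarrow> Mor C" using B mor by fast
    next
      fix f assume f: "f \<in> Mor (Omega d)"
      obtain p q where "f = (p, q)" "p \<le> q" "to_edeg q \<le> d" using mor[OF f] by blast
      then show "rng C (F1 f) = F0 (rng (Omega d) f)" "src C (F1 f) = F0 (src (Omega d) f)"
        "deg C (F1 f) = deg (Omega d) f"
        using B by (simp_all add: Omega_def)
    next
      fix v assume "v \<in> Obj (Omega d)"
      then show "F1 (idt (Omega d) v) = idt C (F0 v)" using A by (simp add: Omega_def)
    next
      fix f g assume f: "f \<in> Mor (Omega d)" and g: "g \<in> Mor (Omega d)"
        and fg: "src (Omega d) f = rng (Omega d) g"
      obtain p q where 1: "f = (p, q)" "p \<le> q" "to_edeg q \<le> d" using mor[OF f] by blast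
      obtain q' r where 2: "g = (q', r)" "q' \<le> r" "to_edeg r \<le> d" using mor[OF g] by blast
      have "q = q'" using fg 1 2 by (simp add: Omega_def)
      then show "F1 (cmp (Omega d) f g) = cmp C (F1 f) (F1 g)"
        using C 1 2 by (simp add: Omega_def)
    qed
  qed
qed

lemma
  assumes "x \<in> boundary_paths C"
  shows bp_Obj: "to_edeg p \<le> pdeg x \<Longrightarrow> pob x p \<in> Obj C"
    and bp_idt: "to_edeg p \<le> pdeg x \<Longrightarrow> pmor x (p, p) = idt C (pob x p)"
    and bp_Mor: "p \<le> q \<Longrightarrow> to_edeg q \<le> pdeg x \<Longrightarrow> pmor x (p, q) \<in> Mor C"
    and bp_rng: "p \<le> q \<Longrightarrow> to_edeg q \<le> pdeg x \<Longrightarrow> rng C (pmor x (p, q)) = pob x p"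
    and bp_src: "p \<le> q \<Longrightarrow> to_edeg q \<le> pdeg x \<Longrightarrow> src C (pmor x (p, q)) = pob x q"
    and bp_deg: "p \<le> q \<Longrightarrow> to_edeg q \<le> pdeg x \<Longrightarrow> deg C (pmor x (p, q)) = q - p"
    and bp_cmp: "p \<le> q \<Longrightarrow> q \<le> r \<Longrightarrow> to_edeg r \<le> pdeg x
      \<Longrightarrow> cmp C (pmor x (p, q)) (pmor x (q, r)) = pmor x (p, r)"
    and bp_maximal: "to_edeg p \<le> pdeg x \<Longrightarrow> enat (p i) = pdeg x i
      \<Longrightarrow> paths_of C (pob x p) (unit_deg i) = {}"
  using assms unfolding boundary_paths_def Omega_functor_iff by auto

lemma bp_outside:
  assumes "x \<in> boundary_paths C"
  shows "\<not> to_edeg p \<le> pdeg x \<Longrightarrow> pob x p = undefined"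
    and "\<not> (p \<le> q \<and> to_edeg q \<le> pdeg x) \<Longrightarrow> pmor x (p, q) = undefined"
  using assms unfolding boundary_paths_def Omega_def extensional_def by auto

text \<open>
  Morphisms determine the objects and the components are extensional, so boundary paths can be
  compared segment by segment.
\<close>

lemma bp_ext:
  assumes x: "x \<in> boundary_paths C" and y: "y \<in> boundary_paths C" and d: "pdeg x = pdeg y"
    and mor: "\<And>p q. p \<le> q \<Longrightarrow> to_edeg q \<le> pdeg x \<Longrightarrow> pmor x (p, q) = pmor y (p, q)"
  shows "x = y"
proof -
  have "pmor x (p, q) = pmor y (p, q)" for p q
    using mor bp_outside(2)[OF x] bp_outside(2)[OF y] d by metis
  then have "pmor x = pmor y" by (simp add: fun_eq_iff)
  moreover have "pob x p = pob y p" for p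
  proof (cases "to_edeg p \<le> pdeg x")
    case True
    then show ?thesis using mor[of p p] bp_rng[OF x, of p p] bp_rng[OF y, of p p] d by simp
  next
    case False
    then show ?thesis using bp_outside(1)[OF x] bp_outside(1)[OF y] d by simp
  qed
  ultimately show ?thesis using d by (intro path.equality) auto
qed

lemma pdeg_shift: "pdeg (shift n x) = pdeg x - to_edeg n"
  by (simp add: shift_def Let_def)

lemma pob_shift:
  "to_edeg n \<le> pdeg x \<Longrightarrow> to_edeg (p + n) \<le> pdeg x \<Longrightarrow> pob (shift n x) p = pob x (p + n)"
  by (simp add: shift_def Let_def Omega_def to_edeg_le_diff_iff)

lemma pmor_shift:
  "to_edeg n \<le> pdeg x \<Longrightarrow> p \<le> q \<Longrightarrow> to_edeg (q + n) \<le> pdeg x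
    \<Longrightarrow> pmor (shift n x) (p, q) = pmor x (p + n, q + n)"
  by (simp add: shift_def Let_def Omega_def to_edeg_le_diff_iff)

lemma shift_bp:
  assumes x: "x \<in> boundary_paths C" and n: "to_edeg n \<le> pdeg x"
  shows "shift n x \<in> boundary_paths C"
proof -
  have le: "p + n \<le> q + n" if "p \<le> q" for p q :: "'c \<Rightarrow> nat"
    using that by (simp add: pointwise)
  have diff: "q + n - (p + n) = q - p" for p q :: "'c \<Rightarrow> nat"
    by (simp add: pointwise)
  have functorial: "degree_functor (Omega (pdeg (shift n x))) C (pob (shift n x)) (pmor (shift n x))"
    unfolding Omega_functor_iff pdeg_shift to_edeg_le_diff_iff[OF n]
  proof (intro conjI allI impI; (elim conjE)?)
    fix p q r :: "'c \<Rightarrow> nat" assume h: "p \<le> q" "q \<le> r" "to_edeg (r + n) \<le> pdeg x"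
    then have "to_edeg (q + n) \<le> pdeg x" "p \<le> r" using le to_edeg_le_mono by (blast, force)
    then show "pmor (shift n x) (p, r) = cmp C (pmor (shift n x) (p, q)) (pmor (shift n x) (q, r))"
      using h by (simp add: pmor_shift n bp_cmp[OF x] le)
  next
    fix p q :: "'c \<Rightarrow> nat" assume h: "p \<le> q" "to_edeg (q + n) \<le> pdeg x"
    then have h': "to_edeg (p + n) \<le> pdeg x" using le to_edeg_le_mono by blast
    show "pmor (shift n x) (p, q) \<in> Mor C"
      "rng C (pmor (shift n x) (p, q)) = pob (shift n x) p"
      "src C (pmor (shift n x) (p, q)) = pob (shift n x) q"
      "deg C (pmor (shift n x) (p, q)) = q - p"
      using h h' by (simp_all add: pmor_shift pob_shift n bp_Mor[OF x] bp_rng[OF x] bp_src[OF x]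
          bp_deg[OF x] le diff)
  qed (simp_all add: pmor_shift pob_shift n bp_Obj[OF x] bp_idt[OF x])
  have "paths_of C (pob (shift n x) p) (unit_deg i) = {}"
    if "to_edeg p \<le> pdeg (shift n x)" "enat (p i) = pdeg (shift n x) i" for p i
  proof -
    have p: "to_edeg (p + n) \<le> pdeg x" using that by (simp add: pdeg_shift to_edeg_le_diff_iff n)
    have "enat ((p + n) i) = pdeg x i"
      using that(2) n[unfolded to_edeg_le_iff, rule_format, of i]
      by (cases "pdeg x i") (auto simp: pdeg_shift to_edeg_def)
    then show ?thesis using bp_maximal[OF x p] by (simp add: pob_shift n p)
  qed
  then show ?thesis
    using functorial unfolding boundary_paths_def by (auto simp: shift_def Let_def)
qed

section \<open>Factorisations in a \<open>k\<close>-graph\<close>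

context k_graph
begin

lemma factor_unique:
  assumes "g \<in> Mor \<Lambda>" "h \<in> Mor \<Lambda>" "src \<Lambda> g = rng \<Lambda> h"
    and "g' \<in> Mor \<Lambda>" "h' \<in> Mor \<Lambda>" "src \<Lambda> g' = rng \<Lambda> h'"
    and "cmp \<Lambda> g h = cmp \<Lambda> g' h'" "deg \<Lambda> g = deg \<Lambda> g'"
  shows "g = g'" "h = h'"
proof -
  have d: "deg \<Lambda> (cmp \<Lambda> g h) = deg \<Lambda> g + deg \<Lambda> h" "deg \<Lambda> (cmp \<Lambda> g h) = deg \<Lambda> g + deg \<Lambda> h'"
    using assms deg_cmp by metis+
  then have "deg \<Lambda> h' = deg \<Lambda> h" by simp
  then have "(g, h) = (g', h')"
    by (intro ex1_unique[OF factorisation[OF cmp_Mor[OF assms(1-3)] d(1)]]) (use assms in simp_all)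
  then show "g = g'" "h = h'" by auto
qed

text \<open>
  The components \<open>f(0, p)\<close> and \<open>f(p, d(f))\<close> of the factorisation of \<open>f\<close> at \<open>p\<close>, meaningful for \<open>p \<le> d(f)\<close>.
\<close>

definition cut :: "'m \<Rightarrow> 'k deg \<Rightarrow> 'm \<times> 'm" where
  "cut f p = (THE (g, h). g \<in> Mor \<Lambda> \<and> h \<in> Mor \<Lambda> \<and> deg \<Lambda> g = p \<and> deg \<Lambda> h = deg \<Lambda> f - p
     \<and> src \<Lambda> g = rng \<Lambda> h \<and> f = cmp \<Lambda> g h)"

definition initial_part :: "'m \<Rightarrow> 'k deg \<Rightarrow> 'm" where
  "initial_part f p = fst (cut f p)"

definition final_part :: "'m \<Rightarrow> 'k deg \<Rightarrow> 'm" where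
  "final_part f p = snd (cut f p)"

lemma
  assumes f: "f \<in> Mor \<Lambda>" and p: "p \<le> deg \<Lambda> f"
  shows initial_part_Mor: "initial_part f p \<in> Mor \<Lambda>"
    and final_part_Mor: "final_part f p \<in> Mor \<Lambda>"
    and deg_initial_part: "deg \<Lambda> (initial_part f p) = p"
    and deg_final_part: "deg \<Lambda> (final_part f p) = deg \<Lambda> f - p"
    and src_initial_part: "src \<Lambda> (initial_part f p) = rng \<Lambda> (final_part f p)"
    and cmp_parts: "cmp \<Lambda> (initial_part f p) (final_part f p) = f"
proof -
  have "deg \<Lambda> f = p + (deg \<Lambda> f - p)" using p by (simp add: deg_add_diff)
  from theI'[OF factorisation[OF f this]]
  have *: "case cut f p of (g, h) \<Rightarrow> g \<in> Mor \<Lambda> \<and> h \<in> Mor \<Lambda> \<and> deg \<Lambda> g = p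
      \<and> deg \<Lambda> h = deg \<Lambda> f - p \<and> src \<Lambda> g = rng \<Lambda> h \<and> f = cmp \<Lambda> g h"
    unfolding cut_def .
  then show "initial_part f p \<in> Mor \<Lambda>" "final_part f p \<in> Mor \<Lambda>" "deg \<Lambda> (initial_part f p) = p"
    "deg \<Lambda> (final_part f p) = deg \<Lambda> f - p" "src \<Lambda> (initial_part f p) = rng \<Lambda> (final_part f p)"
    "cmp \<Lambda> (initial_part f p) (final_part f p) = f"
    unfolding initial_part_def final_part_def by (auto split: prod.splits)
qed

lemma
  assumes "f \<in> Mor \<Lambda>" "p \<le> deg \<Lambda> f"
  shows rng_initial_part: "rng \<Lambda> (initial_part f p) = rng \<Lambda> f"
    and src_final_part: "src \<Lambda> (final_part f p) = src \<Lambda> f"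
  using initial_part_Mor[OF assms] final_part_Mor[OF assms] src_initial_part[OF assms]
    cmp_parts[OF assms] rng_cmp src_cmp by metis+

lemma
  assumes "g \<in> Mor \<Lambda>" "h \<in> Mor \<Lambda>" "src \<Lambda> g = rng \<Lambda> h"
  shows initial_part_cmp: "initial_part (cmp \<Lambda> g h) (deg \<Lambda> g) = g"
    and final_part_cmp: "final_part (cmp \<Lambda> g h) (deg \<Lambda> g) = h"
proof -
  have "deg \<Lambda> g \<le> deg \<Lambda> (cmp \<Lambda> g h)" using assms by (simp add: deg_cmp pointwise)
  note * = this cmp_Mor[OF assms]
  show "initial_part (cmp \<Lambda> g h) (deg \<Lambda> g) = g" "final_part (cmp \<Lambda> g h) (deg \<Lambda> g) = h"
    by (rule factor_unique[OF initial_part_Mor final_part_Mor src_initial_part assms cmp_parts deg_initial_part];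
        fact)+
qed

lemma initial_part_initial_part:
  assumes f: "f \<in> Mor \<Lambda>" and pq: "p \<le> q" and q: "q \<le> deg \<Lambda> f"
  shows "initial_part (initial_part f q) p = initial_part f p"
proof -
  let ?g = "initial_part f q"
  have g: "?g \<in> Mor \<Lambda>" and p: "p \<le> deg \<Lambda> ?g"
    using initial_part_Mor[OF f q] deg_initial_part[OF f q] pq by auto
  have tl: "final_part f q \<in> Mor \<Lambda>" "src \<Lambda> ?g = rng \<Lambda> (final_part f q)"
    using final_part_Mor[OF f q] src_initial_part[OF f q] by auto
  have c: "src \<Lambda> (final_part ?g p) = rng \<Lambda> (final_part f q)" using src_final_part[OF g p] tl by simp
  note m = initial_part_Mor[OF g p] final_part_Mor[OF g p] src_initial_part[OF g p]
  have "f = cmp \<Lambda> (cmp \<Lambda> (initial_part ?g p) (final_part ?g p)) (final_part f q)"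
    using cmp_parts[OF g p] cmp_parts[OF f q] by simp
  also have "\<dots> = cmp \<Lambda> (initial_part ?g p) (cmp \<Lambda> (final_part ?g p) (final_part f q))"
    using m tl c by (simp add: cmp_assoc)
  finally have "initial_part f (deg \<Lambda> (initial_part ?g p)) = initial_part ?g p"
    using m tl c initial_part_cmp cmp_Mor rng_cmp by metis
  then show ?thesis using deg_initial_part[OF g p] by simp
qed

lemma deg_zero:
  assumes f: "f \<in> Mor \<Lambda>" "deg \<Lambda> f = 0"
  shows "f = idt \<Lambda> (rng \<Lambda> f)" "src \<Lambda> f = rng \<Lambda> f"
proof -
  note v = rng_Obj[OF f(1)] and w = src_Obj[OF f(1)]
  show *: "f = idt \<Lambda> (rng \<Lambda> f)"
    by (rule factor_unique(1)[of f "idt \<Lambda> (src \<Lambda> f)" _ f])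
      (use f v w in \<open>simp_all add: idt_Mor rng_idt src_idt cmp_idt idt_cmp deg_idt\<close>)
  show "src \<Lambda> f = rng \<Lambda> f" by (subst *) (simp add: src_idt v)
qed

lemma initial_part_deg: "f \<in> Mor \<Lambda> \<Longrightarrow> initial_part f (deg \<Lambda> f) = f"
  using initial_part_cmp[of f "idt \<Lambda> (src \<Lambda> f)"]
  by (simp add: idt_Mor rng_idt src_Obj cmp_idt)

lemma final_part_zero: "f \<in> Mor \<Lambda> \<Longrightarrow> final_part f 0 = f"
  using final_part_cmp[of "idt \<Lambda> (rng \<Lambda> f)" f]
  by (simp add: idt_Mor src_idt rng_Obj idt_cmp deg_idt)

lemma final_part_deg: "f \<in> Mor \<Lambda> \<Longrightarrow> final_part f (deg \<Lambda> f) = idt \<Lambda> (src \<Lambda> f)"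
  using final_part_cmp[of f "idt \<Lambda> (src \<Lambda> f)"]
  by (simp add: idt_Mor rng_idt src_Obj cmp_idt)

text \<open>
  Subsegments are factors in prescribed degrees, hence unique.
\<close>

lemma bp_segment_eq:
  assumes x: "x \<in> boundary_paths \<Lambda>" and y: "y \<in> boundary_paths \<Lambda>"
    and xs: "p \<le> a" "a \<le> b" "b \<le> q" "to_edeg q \<le> pdeg x"
    and ys: "p' \<le> a'" "a' \<le> b'" "b' \<le> q'" "to_edeg q' \<le> pdeg y"
    and eq: "pmor x (p, q) = pmor y (p', q')" and d: "a - p = a' - p'" "b - a = b' - a'"
  shows "pmor x (a, b) = pmor y (a', b')"
proof -
  have xb: "to_edeg b \<le> pdeg x" "to_edeg a \<le> pdeg x" "a \<le> q"
    and yb: "to_edeg b' \<le> pdeg y" "to_edeg a' \<le> pdeg y" "a' \<le> q'"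
    using xs ys to_edeg_le_mono order_trans by metis+
  have "pmor x (a, q) = pmor y (a', q')"
    by (rule factor_unique(2)[of "pmor x (p, a)" _ "pmor y (p', a')"])
      (use xs ys xb yb d eq in \<open>simp_all add: bp_Mor[OF x] bp_Mor[OF y] bp_rng[OF x] bp_rng[OF y]
         bp_src[OF x] bp_src[OF y] bp_deg[OF x] bp_deg[OF y] bp_cmp[OF x] bp_cmp[OF y]\<close>)
  then show ?thesis
    by (intro factor_unique(1)[of "pmor x (a, b)" "pmor x (b, q)" _ "pmor y (b', q')"])
      (use xs ys xb yb d in \<open>simp_all add: bp_Mor[OF x] bp_Mor[OF y] bp_rng[OF x] bp_rng[OF y]
         bp_src[OF x] bp_src[OF y] bp_deg[OF x] bp_deg[OF y] bp_cmp[OF x] bp_cmp[OF y]\<close>)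
qed

text \<open>
  It suffices to compare initial segments, and only cofinally many of them.
\<close>

lemma bp_eqI:
  assumes x: "x \<in> boundary_paths \<Lambda>" and y: "y \<in> boundary_paths \<Lambda>" and d: "pdeg x = pdeg y"
    and ini: "\<And>p. to_edeg p \<le> pdeg x
      \<Longrightarrow> \<exists>q. p \<le> q \<and> to_edeg q \<le> pdeg x \<and> pmor x (0, q) = pmor y (0, q)"
  shows "x = y"
proof -
  have "pmor x (p, q) = pmor y (p, q)" if pq: "p \<le> q" and q: "to_edeg q \<le> pdeg x" for p q
  proof -
    obtain r where "q \<le> r" "to_edeg r \<le> pdeg x" "pmor x (0, r) = pmor y (0, r)"
      using ini[OF q] by blast
    then show ?thesis
      using bp_segment_eq[OF x y zero_le_deg pq _ _ zero_le_deg pq] d by auto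
  qed
  then show ?thesis by (rule bp_ext[OF x y d])
qed

section \<open>Boundary paths from coherent families of initial segments\<close>

text \<open>
  \<open>F p\<close> is to be the initial segment of degree \<open>p\<close> of the path; the segment from \<open>p\<close> to \<open>q\<close> is then
  what remains of \<open>F q\<close> after \<open>p\<close>.
\<close>

definition path_from :: "'k edeg \<Rightarrow> ('k deg \<Rightarrow> 'm) \<Rightarrow> ('o, 'm, 'k) path" where
  "path_from D F = \<lparr>pdeg = D,
     pob = restrict (\<lambda>p. src \<Lambda> (F p)) (Obj (Omega D)),
     pmor = restrict (\<lambda>(p, q). final_part (F q) p) (Mor (Omega D))\<rparr>"

lemma
  shows pdeg_path_from: "pdeg (path_from D F) = D"
    and pob_path_from: "to_edeg p \<le> D \<Longrightarrow> pob (path_from D F) p = src \<Lambda> (F p)"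
    and pmor_path_from: "p \<le> q \<Longrightarrow> to_edeg q \<le> D
      \<Longrightarrow> pmor (path_from D F) (p, q) = final_part (F q) p"
  by (simp_all add: path_from_def Omega_def)

text \<open>
  Coherence makes \<open>F q\<close> the composite of \<open>F p\<close> with the segment from \<open>p\<close> to \<open>q\<close>, so functoriality is
  associativity together with uniqueness of factorisations. Both constructions of boundary paths below go
  through this lemma.
\<close>

lemma path_from_bp:
  assumes F: "\<And>p. to_edeg p \<le> D \<Longrightarrow> F p \<in> Mor \<Lambda> \<and> deg \<Lambda> (F p) = p"
    and coherent: "\<And>p q. p \<le> q \<Longrightarrow> to_edeg q \<le> D \<Longrightarrow> initial_part (F q) p = F p"
    and maximal: "\<And>p i. to_edeg p \<le> D \<Longrightarrow> enat (p i) = D i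
      \<Longrightarrow> paths_of \<Lambda> (src \<Lambda> (F p)) (unit_deg i) = {}"
  shows "path_from D F \<in> boundary_paths \<Lambda>"
proof -
  let ?x = "path_from D F"
  have "degree_functor (Omega D) \<Lambda> (pob ?x) (pmor ?x)"
    unfolding Omega_functor_iff
  proof (intro conjI allI impI; (elim conjE)?)
    fix p assume p: "to_edeg p \<le> D"
    then show "pob ?x p \<in> Obj \<Lambda>" using F by (simp add: pob_path_from src_Obj)
    have "final_part (F p) p = idt \<Lambda> (src \<Lambda> (F p))"
      using final_part_deg[of "F p"] F[OF p] by simp
    then show "pmor ?x (p, p) = idt \<Lambda> (pob ?x p)"
      using p by (simp add: pob_path_from pmor_path_from)
  next
    fix p q :: "'k deg" assume pq: "p \<le> q" and q: "to_edeg q \<le> D"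
    note p = to_edeg_le_mono[OF pq q]
    have m: "F q \<in> Mor \<Lambda>" "p \<le> deg \<Lambda> (F q)" "deg \<Lambda> (F q) = q" using F[OF q] pq by auto
    show "pmor ?x (p, q) \<in> Mor \<Lambda>" "rng \<Lambda> (pmor ?x (p, q)) = pob ?x p"
      "src \<Lambda> (pmor ?x (p, q)) = pob ?x q" "deg \<Lambda> (pmor ?x (p, q)) = q - p"
      using p q pq coherent[OF pq q] final_part_Mor[OF m(1,2)] deg_final_part[OF m(1,2)]
        src_initial_part[OF m(1,2)] src_final_part[OF m(1,2)] m(3)
      by (simp_all add: pob_path_from pmor_path_from)
  next
    fix p q r :: "'k deg" assume pq: "p \<le> q" and qr: "q \<le> r" and r: "to_edeg r \<le> D"
    note q = to_edeg_le_mono[OF qr r] and pr = order_trans[OF pq qr]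
    note p = to_edeg_le_mono[OF pq q]
    have m: "F r \<in> Mor \<Lambda>" "q \<le> deg \<Lambda> (F r)" "F q \<in> Mor \<Lambda>" "p \<le> deg \<Lambda> (F q)"
      using F[OF r] F[OF q] pq qr by auto
    let ?a = "F p" and ?b = "final_part (F q) p" and ?c = "final_part (F r) q"
    have abc: "?a \<in> Mor \<Lambda>" "deg \<Lambda> ?a = p" "?b \<in> Mor \<Lambda>" "?c \<in> Mor \<Lambda>"
      "src \<Lambda> ?a = rng \<Lambda> ?b" "src \<Lambda> ?b = rng \<Lambda> ?c"
      using F[OF p] final_part_Mor[OF m(1,2)] final_part_Mor[OF m(3,4)]
        src_initial_part[OF m(1,2)] src_initial_part[OF m(3,4)] src_final_part[OF m(3,4)]
        coherent[OF pq q] coherent[OF qr r] by simp_all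
    have "F r = cmp \<Lambda> (cmp \<Lambda> ?a ?b) ?c"
      using cmp_parts[OF m(1,2)] cmp_parts[OF m(3,4)] coherent[OF pq q] coherent[OF qr r] by simp
    also have "\<dots> = cmp \<Lambda> ?a (cmp \<Lambda> ?b ?c)" using abc by (simp add: cmp_assoc)
    finally have "final_part (F r) p = cmp \<Lambda> ?b ?c"
      using final_part_cmp[of ?a "cmp \<Lambda> ?b ?c"] abc by (simp add: cmp_Mor rng_cmp)
    then show "pmor ?x (p, r) = cmp \<Lambda> (pmor ?x (p, q)) (pmor ?x (q, r))"
      using pq qr pr q r by (simp add: pmor_path_from)
  qed
  then show ?thesis
    unfolding boundary_paths_def using maximal
    by (simp add: pdeg_path_from pob_path_from) (simp add: path_from_def)
qed

end

section \<open>Local convexity and the construction of boundary paths\<close>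

text \<open>
  A schedule in which every direction has its turn again and again, for building paths that stop only
  where they must.
\<close>

lemma ex_infinitely_recurrent: "\<exists>idx :: nat \<Rightarrow> 'k::finite. \<forall>i c. \<exists>c'\<ge>c. idx c' = i"
proof -
  obtain h :: "nat \<Rightarrow> 'k" where h: "bij_betw h {0..<card (UNIV :: 'k set)} UNIV"
    using ex_bij_betw_nat_finite[OF finite_UNIV] by blast
  have "\<exists>c'\<ge>c. h (c' mod card (UNIV :: 'k set)) = i" for i c
  proof -
    obtain l where "l < card (UNIV :: 'k set)" "h l = i"
      using bij_betw_imp_surj_on[OF h] by (metis UNIV_I atLeastLessThan_iff imageE)
    moreover from this have "c \<le> c * card (UNIV :: 'k set) + l" by (intro trans_le_add1) simp
    ultimately show ?thesis by (intro exI[of _ "c * card (UNIV :: 'k set) + l"]) simp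
  qed
  then show ?thesis by (intro exI[of _ "\<lambda>c. h (c mod card (UNIV :: 'k set))"]) blast
qed

locale locally_convex_k_graph = k_graph \<Lambda> for \<Lambda> :: "('o, 'm, 'k::finite) graded_cat" +
  assumes lc: "locally_convex \<Lambda>"
begin

text \<open>
  If an edge in direction \<open>i\<close> starts where \<open>f\<close> starts, and \<open>f\<close> itself does not move in direction \<open>i\<close>, then the
  edge can be pushed along \<open>f\<close>, one edge of \<open>f\<close> at a time, each step being an instance of local
  convexity. Read contrapositively: a path that cannot be extended in direction \<open>i\<close> at some point could
  not be extended at an earlier point with the same \<open>i\<close>-th coordinate either. This is how the boundary
  condition is checked at points where it is not given directly.
\<close>

lemma extension_transfer:
  assumes f: "f \<in> Mor \<Lambda>" "deg \<Lambda> f i = 0"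
    and ex: "paths_of \<Lambda> (rng \<Lambda> f) (unit_deg i) \<noteq> {}"
  shows "paths_of \<Lambda> (src \<Lambda> f) (unit_deg i) \<noteq> {}"
  using f ex
proof (induction "sum (deg \<Lambda> f) UNIV" arbitrary: f rule: less_induct)
  case less
  show ?case
  proof (cases "deg \<Lambda> f = 0")
    case True
    then show ?thesis using less deg_zero(2) by simp
  next
    case False
    then obtain j where j: "deg \<Lambda> f j \<noteq> 0" by (auto simp: fun_eq_iff)
    then have ij: "i \<noteq> j" using less by auto
    have e: "unit_deg j \<le> deg \<Lambda> f" using j by (auto simp: unit_deg_def le_fun_def)
    note m = initial_part_Mor[OF less(2) e] final_part_Mor[OF less(2) e]
    obtain g where g: "g \<in> Mor \<Lambda>" "deg \<Lambda> g = unit_deg i" "rng \<Lambda> g = rng \<Lambda> f"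
      using less.prems(3) by (auto simp: paths_of_def)
    have "paths_of \<Lambda> (src \<Lambda> (initial_part f (unit_deg j))) (unit_deg i) \<noteq> {}"
      using lc ij g m(1) deg_initial_part[OF less(2) e] rng_initial_part[OF less(2) e]
      unfolding locally_convex_def by metis
    moreover have "sum (deg \<Lambda> (final_part f (unit_deg j))) UNIV < sum (deg \<Lambda> f) UNIV"
    proof (rule sum_strict_mono_ex1)
      show "\<exists>k\<in>UNIV. deg \<Lambda> (final_part f (unit_deg j)) k < deg \<Lambda> f k"
        using j fun_cong[OF unit_deg_def[of j], of j] by (intro bexI[of _ j]) (simp_all add: deg_final_part[OF less(2) e])
    qed (auto simp: deg_final_part[OF less(2) e])
    ultimately have "paths_of \<Lambda> (src \<Lambda> (final_part f (unit_deg j))) (unit_deg i) \<noteq> {}"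
      using less m(2) src_initial_part[OF less(2) e] by (simp add: deg_final_part[OF less(2) e])
    then show ?thesis using src_final_part[OF less(2) e] by simp
  qed
qed

text \<open>
  The initial segments of \<open>f x\<close> are cut out of the finite paths \<open>f x(0, q)\<close>. The boundary condition at a
  point \<open>p\<close> that does not lie beyond \<open>d(f)\<close> is reduced to that of \<open>x\<close> by pushing a hypothetical edge
  along the remaining part of \<open>f x(0, q)\<close>.
\<close>

lemma prepend_ex1:
  assumes f: "f \<in> Mor \<Lambda>" and x: "x \<in> boundary_paths \<Lambda>"
    and fx: "src \<Lambda> f = pob x 0"
  shows "\<exists>!z. z \<in> boundary_paths \<Lambda> \<and> pdeg z = to_edeg (deg \<Lambda> f) + pdeg x \<and>
     pmor z (0, deg \<Lambda> f) = f \<and> shift (deg \<Lambda> f) z = x"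
proof (rule ex_ex1I)
  let ?d = "deg \<Lambda> f"
  define D where "D = to_edeg ?d + pdeg x"
  define G where "G = (\<lambda>q. cmp \<Lambda> f (pmor x (0, q)))"
  define F where "F = (\<lambda>p. initial_part (G (p - ?d)) p)"
  have below: "to_edeg (p - ?d) \<le> pdeg x" if "to_edeg p \<le> D" for p
    unfolding to_edeg_le_iff
  proof
    fix i show "enat ((p - ?d) i) \<le> pdeg x i"
      using that[unfolded to_edeg_le_iff, rule_format, of i]
      by (cases "pdeg x i") (auto simp: D_def to_edeg_def)
  qed
  have above: "to_edeg (?d + q) \<le> D" if "to_edeg q \<le> pdeg x" for q
    unfolding to_edeg_le_iff
  proof
    fix i show "enat ((?d + q) i) \<le> D i"
      using that[unfolded to_edeg_le_iff, rule_format, of i]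
      by (cases "pdeg x i") (auto simp: D_def to_edeg_def)
  qed
  have G: "G q \<in> Mor \<Lambda>" "deg \<Lambda> (G q) = ?d + q" "src \<Lambda> (G q) = pob x q"
    "initial_part (G q) ?d = f" "final_part (G q) ?d = pmor x (0, q)"
    if "to_edeg q \<le> pdeg x" for q
  proof -
    have xq: "pmor x (0, q) \<in> Mor \<Lambda>" "src \<Lambda> f = rng \<Lambda> (pmor x (0, q))"
      using fx x zero_le_deg that by (simp_all add: bp_Mor bp_rng)
    then show "G q \<in> Mor \<Lambda>" "deg \<Lambda> (G q) = ?d + q" "src \<Lambda> (G q) = pob x q"
      "initial_part (G q) ?d = f" "final_part (G q) ?d = pmor x (0, q)"
      unfolding G_def using f x that zero_le_deg
      by (simp_all add: cmp_Mor deg_cmp src_cmp bp_deg bp_src initial_part_cmp final_part_cmp)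
  qed
  have G_mono: "initial_part (G q) (?d + p) = G p" if pq: "p \<le> q" "to_edeg q \<le> pdeg x" for p q
  proof -
    have p: "to_edeg p \<le> pdeg x" using pq to_edeg_le_mono by blast
    have m: "pmor x (0, p) \<in> Mor \<Lambda>" "pmor x (p, q) \<in> Mor \<Lambda>" "src \<Lambda> f = rng \<Lambda> (pmor x (0, p))"
      "src \<Lambda> (pmor x (0, p)) = rng \<Lambda> (pmor x (p, q))"
      using fx x p pq zero_le_deg by (simp_all add: bp_Mor bp_rng bp_src)
    have "G q = cmp \<Lambda> (G p) (pmor x (p, q))"
      unfolding G_def using m f bp_cmp[OF x zero_le_deg pq] by (simp add: cmp_assoc)
    then show ?thesis
      using initial_part_cmp[of "G p" "pmor x (p, q)"] m G[OF p] bp_rng[OF x pq] by simp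
  qed
  have le: "p \<le> ?d + (p - ?d)" for p by (auto simp: le_fun_def)
  have F: "F p \<in> Mor \<Lambda>" "deg \<Lambda> (F p) = p" if "to_edeg p \<le> D" for p
    using G[OF below[OF that]] le unfolding F_def
    by (simp_all add: initial_part_Mor deg_initial_part)
  \<comment> \<open>Cutting at \<open>p - d(f)\<close> was only the smallest choice; any longer segment of \<open>x\<close> gives the same path.\<close>
  have F_eq: "F p = initial_part (G q) p" if "p \<le> ?d + q" "to_edeg q \<le> pdeg x" for p q
  proof -
    have "p i - ?d i \<le> q i" for i using that(1)[unfolded le_fun_def, rule_format, of i] by simp
    then have q: "p - ?d \<le> q" by (simp add: le_fun_def)
    then have "?d + (p - ?d) \<le> deg \<Lambda> (G q)" using G[OF that(2)] by (simp add: le_fun_def)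
    then show ?thesis
      unfolding F_def G_mono[OF q that(2), symmetric]
      using G(1)[OF that(2)] le by (simp add: initial_part_initial_part)
  qed
  have coherent: "initial_part (F q) p = F p" if pq: "p \<le> q" and q: "to_edeg q \<le> D" for p q
  proof -
    have "F p = initial_part (G (q - ?d)) p"
      using order_trans[OF pq le] below[OF q] by (rule F_eq)
    then show ?thesis
      using G[OF below[OF q]] le pq by (simp add: F_def initial_part_initial_part)
  qed
  have maximal: "paths_of \<Lambda> (src \<Lambda> (F p)) (unit_deg i) = {}"
    if p: "to_edeg p \<le> D" and i: "enat (p i) = D i" for p i
  proof (rule ccontr)
    \<comment> \<open>As \<open>p\<close> and \<open>d(f) + q\<close> agree in coordinate \<open>i\<close>, the path \<open>h\<close> between them does not move there.\<close>
    let ?q = "p - ?d"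
    let ?h = "final_part (G ?q) p"
    note Gq = G[OF below[OF p]]
    have pG: "p \<le> deg \<Lambda> (G ?q)" using Gq le by simp
    have x_i: "enat (?q i) = pdeg x i" "deg \<Lambda> ?h i = 0"
      using i Gq by (cases "pdeg x i"; simp add: D_def to_edeg_def deg_final_part[OF Gq(1) pG])+
    assume "paths_of \<Lambda> (src \<Lambda> (F p)) (unit_deg i) \<noteq> {}"
    then have "paths_of \<Lambda> (src \<Lambda> ?h) (unit_deg i) \<noteq> {}"
      using extension_transfer[OF final_part_Mor[OF Gq(1) pG] x_i(2)] src_initial_part[OF Gq(1) pG]
      by (simp add: F_def)
    then show False
      using bp_maximal[OF x below[OF p] x_i(1)] Gq(3) src_final_part[OF Gq(1) pG] by simp
  qed
  let ?z = "path_from D F"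
  have z: "?z \<in> boundary_paths \<Lambda>" using F coherent maximal by (intro path_from_bp) auto
  have dD: "to_edeg ?d \<le> D" using above[OF to_edeg_zero_le] by simp
  have "pmor ?z (0, ?d) = F ?d"
    using F[OF dD] by (simp add: pmor_path_from zero_le_deg dD final_part_zero)
  also have "\<dots> = f"
    using F_eq[of ?d 0] G[OF to_edeg_zero_le] by (simp add: zero_le_deg to_edeg_zero_le)
  finally have ini: "pmor ?z (0, ?d) = f" .
  have "shift ?d ?z = x"
  proof (rule bp_eqI)
    show s: "shift ?d ?z \<in> boundary_paths \<Lambda>" using shift_bp[OF z] dD by (simp add: pdeg_path_from)
    show "x \<in> boundary_paths \<Lambda>" by fact
    have "D i - to_edeg ?d i = pdeg x i" for i
      by (cases "pdeg x i") (auto simp: D_def to_edeg_def)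
    then show dx: "pdeg (shift ?d ?z) = pdeg x"
      by (simp add: pdeg_shift pdeg_path_from fun_eq_iff)
    fix q assume q: "to_edeg q \<le> pdeg (shift ?d ?z)"
    then have qx: "to_edeg q \<le> pdeg x" using dx by simp
    have "pmor (shift ?d ?z) (0, q) = pmor ?z (?d, ?d + q)"
      using above[OF qx] dD zero_le_deg by (simp add: pmor_shift pdeg_path_from add.commute)
    also have "\<dots> = final_part (F (?d + q)) ?d"
      using above[OF qx] by (simp add: pmor_path_from le_fun_def)
    also have "F (?d + q) = G q"
      using F_eq[of "?d + q" q] G_mono[of q q] qx by simp
    also have "final_part (G q) ?d = pmor x (0, q)" by (rule G(5)[OF qx])
    finally have "pmor (shift ?d ?z) (0, q) = pmor x (0, q)" .
    then show "\<exists>r. q \<le> r \<and> to_edeg r \<le> pdeg (shift ?d ?z)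
        \<and> pmor (shift ?d ?z) (0, r) = pmor x (0, r)" using q by blast
  qed
  then show "\<exists>z. z \<in> boundary_paths \<Lambda> \<and> pdeg z = to_edeg ?d + pdeg x \<and>
     pmor z (0, ?d) = f \<and> shift ?d z = x"
    using z ini by (intro exI[of _ ?z]) (simp add: pdeg_path_from D_def)
next
  let ?d = "deg \<Lambda> f"
  have ini: "pmor z (0, ?d + q) = cmp \<Lambda> f (pmor x (0, q))"
    if "z \<in> boundary_paths \<Lambda> \<and> pdeg z = to_edeg ?d + pdeg x \<and> pmor z (0, ?d) = f \<and> shift ?d z = x"
      and q: "to_edeg (?d + q) \<le> pdeg z" for z q
  proof -
    have z: "z \<in> boundary_paths \<Lambda>" "pmor z (0, ?d) = f" "shift ?d z = x" using that by auto
    \<comment> \<open>Any such \<open>z\<close> has \<open>f x(0, q)\<close> as its initial segments beyond \<open>d(f)\<close>, and these are cofinal.\<close>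
    have dq: "?d \<le> ?d + q" by (simp add: le_fun_def)
    have "pmor x (0, q) = pmor z (?d, ?d + q)"
      using z(3) q to_edeg_le_mono[OF dq q] pmor_shift[of ?d z 0 q]
      by (simp add: zero_le_deg add.commute)
    then show ?thesis using bp_cmp[OF z(1) zero_le_deg dq q] z(2) by simp
  qed
  fix z z'
  assume z: "z \<in> boundary_paths \<Lambda> \<and> pdeg z = to_edeg ?d + pdeg x \<and> pmor z (0, ?d) = f
      \<and> shift ?d z = x"
    and z': "z' \<in> boundary_paths \<Lambda> \<and> pdeg z' = to_edeg ?d + pdeg x \<and> pmor z' (0, ?d) = f
      \<and> shift ?d z' = x"
  show "z = z'"
  proof (rule bp_eqI)
    fix p assume p: "to_edeg p \<le> pdeg z"
    let ?q = "?d + (p - ?d)"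
    have "to_edeg ?q \<le> pdeg z"
      unfolding to_edeg_le_iff
    proof
      fix i show "enat (?q i) \<le> pdeg z i"
        using p[unfolded to_edeg_le_iff, rule_format, of i] z
        by (cases "pdeg x i") (auto simp: to_edeg_def)
    qed
    moreover have "p \<le> ?q" by (auto simp: le_fun_def)
    ultimately show "\<exists>q. p \<le> q \<and> to_edeg q \<le> pdeg z \<and> pmor z (0, q) = pmor z' (0, q)"
      using ini[OF z] ini[OF z'] z z' by metis
  qed (use z z' in auto)
qed

lemma
  assumes "f \<in> Mor \<Lambda>" "x \<in> boundary_paths \<Lambda>" "src \<Lambda> f = pob x 0"
  shows prepend_bp: "prepend \<Lambda> f x \<in> boundary_paths \<Lambda>"
    and pdeg_prepend: "pdeg (prepend \<Lambda> f x) = to_edeg (deg \<Lambda> f) + pdeg x"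
    and pmor_prepend: "pmor (prepend \<Lambda> f x) (0, deg \<Lambda> f) = f"
    and shift_prepend: "shift (deg \<Lambda> f) (prepend \<Lambda> f x) = x"
  using theI'[OF prepend_ex1[OF assms]] unfolding prepend_def by auto

text \<open>
  Start at \<open>u\<close> and extend by an edge in the scheduled direction whenever there is one. The limit has as
  its degree the supremum of the degrees of the finite stages. It is a boundary path: an edge that
  starts at a point \<open>p\<close>, in a direction \<open>i\<close> in which \<open>p\<close> has already reached the final degree, could be pushed to a
  later stage at which direction \<open>i\<close> is scheduled, and would have been used there, giving a path longer
  in direction \<open>i\<close> than the supremum allows.
\<close>

lemma boundary_path_exists:
  assumes u: "u \<in> Obj \<Lambda>"
  shows "\<exists>x \<in> boundary_paths \<Lambda>. pob x 0 = u"
proof -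
  obtain idx :: "nat \<Rightarrow> 'k" where idx: "\<And>i c. \<exists>c'\<ge>c. idx c' = i"
    using ex_infinitely_recurrent by blast
  define ext where "ext = (\<lambda>c h. if paths_of \<Lambda> (src \<Lambda> h) (unit_deg (idx c)) = {} then h
      else cmp \<Lambda> h (SOME g. g \<in> paths_of \<Lambda> (src \<Lambda> h) (unit_deg (idx c))))"
  define f where "f = rec_nat (idt \<Lambda> u) ext"
  have f_Suc: "(paths_of \<Lambda> (src \<Lambda> (f c)) (unit_deg (idx c)) = {} \<and> f (Suc c) = f c) \<or>
      (\<exists>g \<in> paths_of \<Lambda> (src \<Lambda> (f c)) (unit_deg (idx c)). f (Suc c) = cmp \<Lambda> (f c) g)" for c
    unfolding f_def by (auto simp: ext_def some_in_eq intro: bexI[OF _ someI_ex])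
  have f: "f c \<in> Mor \<Lambda> \<and> rng \<Lambda> (f c) = u" for c
  proof (induction c)
    case 0
    then show ?case using u by (simp add: f_def idt_Mor rng_idt)
  next
    case (Suc c)
    then show ?case using f_Suc[of c] by (auto simp: paths_of_def cmp_Mor rng_cmp)
  qed
  have f_step: "deg \<Lambda> (f c) \<le> deg \<Lambda> (f (Suc c))
      \<and> initial_part (f (Suc c)) (deg \<Lambda> (f c)) = f c" for c
    using f_Suc[of c] f[of c]
    by (auto simp: paths_of_def deg_cmp initial_part_deg initial_part_cmp le_fun_def)
  have f_mono: "deg \<Lambda> (f c) \<le> deg \<Lambda> (f c') \<and> initial_part (f c') (deg \<Lambda> (f c)) = f c"
    if "c \<le> c'" for c c'
    using that
  proof (induction c' rule: dec_induct)
    case base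
    show ?case using f by (simp add: initial_part_deg)
  next
    case (step c')
    then show ?case
      using f_step[of c'] f initial_part_initial_part[of "f (Suc c')"]
      by (metis order_trans)
  qed
  define D where "D = (\<lambda>i. SUP c. enat (deg \<Lambda> (f c) i))"
  \<comment> \<open>The stages increase, so finitely many coordinates can be reached simultaneously.\<close>
  have reached: "\<exists>c. p \<le> deg \<Lambda> (f c)" if p: "to_edeg p \<le> D" for p
  proof -
    have "\<exists>c. p i \<le> deg \<Lambda> (f c) i" for i
    proof (cases "p i")
      case (Suc l)
      have "enat (p i) \<le> D i" using p by (simp add: to_edeg_le_iff)
      then have "enat l < D i" using Suc by (simp add: Suc_ile_eq)
      then show ?thesis using Suc by (auto simp: D_def less_SUP_iff Suc_le_eq)
    qed simp
    then obtain C where C: "\<And>i. p i \<le> deg \<Lambda> (f (C i)) i" by metis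
    have "p i \<le> deg \<Lambda> (f (Max (range C))) i" for i
    proof -
      have "C i \<le> Max (range C)" by simp
      then show ?thesis using C[of i] f_mono le_fun_def order_trans by metis
    qed
    then show ?thesis by (auto simp: le_fun_def)
  qed
  have below: "to_edeg (deg \<Lambda> (f c)) \<le> D" for c
    unfolding to_edeg_le_iff D_def by (auto intro: SUP_upper)
  define F where "F = (\<lambda>p. initial_part (f (SOME c. p \<le> deg \<Lambda> (f c))) p)"
  have F_eq: "F p = initial_part (f c) p" if p: "p \<le> deg \<Lambda> (f c)" for p c
  proof -
    have const: "initial_part (f c) p = initial_part (f c') p"
      if "c \<le> c'" "p \<le> deg \<Lambda> (f c)" for c c'
      using f_mono[OF that(1)] f initial_part_initial_part[of "f c'" p "deg \<Lambda> (f c)"] that(2) by simp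
    have "p \<le> deg \<Lambda> (f (SOME c. p \<le> deg \<Lambda> (f c)))" using p by (rule someI)
    then show ?thesis unfolding F_def using const p by (metis linear)
  qed
  have F: "F p \<in> Mor \<Lambda> \<and> deg \<Lambda> (F p) = p \<and> rng \<Lambda> (F p) = u" if p: "to_edeg p \<le> D" for p
    using reached[OF p] F_eq[of p] f initial_part_Mor deg_initial_part rng_initial_part by metis
  have coherent: "initial_part (F q) p = F p" if pq: "p \<le> q" and q: "to_edeg q \<le> D" for p q
  proof -
    obtain c where c: "q \<le> deg \<Lambda> (f c)" using reached[OF q] by blast
    then show ?thesis
      using F_eq[OF c] F_eq[OF order_trans[OF pq c]] initial_part_initial_part[OF _ pq c] f by simp
  qed
  have maximal: "paths_of \<Lambda> (src \<Lambda> (F p)) (unit_deg i) = {}"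
    if p: "to_edeg p \<le> D" and i: "enat (p i) = D i" for p i
  proof (rule ccontr)
    assume ne: "paths_of \<Lambda> (src \<Lambda> (F p)) (unit_deg i) \<noteq> {}"
    have deg_i: "deg \<Lambda> (f c) i \<le> p i" for c
      using below[of c] i unfolding to_edeg_le_iff by (metis enat_ord_simps(1))
    obtain c0 where c0: "p \<le> deg \<Lambda> (f c0)" using reached[OF p] by blast
    obtain c where c: "c0 \<le> c" "idx c = i" using idx by blast
    have pc: "p \<le> deg \<Lambda> (f c)" using c0 f_mono[OF c(1)] by (blast intro: order_trans)
    note fc = conjunct1[OF f[of c]]
    let ?h = "final_part (f c) p"
    have "deg \<Lambda> ?h i = 0" using deg_i[of c] by (simp add: deg_final_part[OF fc pc])
    then have "paths_of \<Lambda> (src \<Lambda> ?h) (unit_deg i) \<noteq> {}"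
      using extension_transfer[OF final_part_Mor[OF fc pc]] ne src_initial_part[OF fc pc] F_eq[OF pc]
      by simp
    then have "paths_of \<Lambda> (src \<Lambda> (f c)) (unit_deg (idx c)) \<noteq> {}"
      using src_final_part[OF fc pc] c by simp
    then obtain g where g: "g \<in> Mor \<Lambda>" "rng \<Lambda> g = src \<Lambda> (f c)" "deg \<Lambda> g = unit_deg i"
      "f (Suc c) = cmp \<Lambda> (f c) g"
      using f_Suc[of c] c by (auto simp: paths_of_def)
    then have "deg \<Lambda> (f (Suc c)) i = deg \<Lambda> (f c) i + 1"
      using fc fun_cong[OF unit_deg_def[of i], of i] by (simp add: deg_cmp)
    moreover have "p i \<le> deg \<Lambda> (f c) i" using pc by (simp add: le_fun_def)
    ultimately show False using deg_i[of "Suc c"] by simp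
  qed
  have bp: "path_from D F \<in> boundary_paths \<Lambda>" using F coherent maximal by (intro path_from_bp) auto
  have "deg \<Lambda> (F 0) = 0" "F 0 \<in> Mor \<Lambda>" "rng \<Lambda> (F 0) = u" using F[OF to_edeg_zero_le] by auto
  then have "pob (path_from D F) 0 = u"
    using deg_zero(2)[of "F 0"] by (simp only: pob_path_from[OF to_edeg_zero_le])
  then show ?thesis using bp by blast
qed

end

section \<open>The two equivalence relations\<close>

lemma P_rel_iff:
  "((x, m, n), (y, p, q)) \<in> P_rel \<Lambda> \<longleftrightarrow>
     x \<in> boundary_paths \<Lambda> \<and> y \<in> boundary_paths \<Lambda> \<and> m \<le> n \<and> p \<le> q \<and>
     pmor x (meet m (pdeg x), meet n (pdeg x)) = pmor y (meet p (pdeg y), meet q (pdeg y)) \<and>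
     m - meet m (pdeg x) = p - meet p (pdeg y) \<and> n - m = q - p"
  by (simp add: P_rel_def)

lemma V_rel_iff:
  "((x, m), (y, n)) \<in> V_rel \<Lambda> \<longleftrightarrow> x \<in> boundary_paths \<Lambda> \<and> y \<in> boundary_paths \<Lambda> \<and>
     pob x (meet m (pdeg x)) = pob y (meet n (pdeg y)) \<and>
     m - meet m (pdeg x) = n - meet n (pdeg y)"
  by (simp add: V_rel_def)

lemma equiv_V_rel: "equiv (boundary_paths \<Lambda> \<times> UNIV) (V_rel \<Lambda>)"
  by (rule equivI) (auto simp: V_rel_def refl_on_def sym_def trans_def)

lemma equiv_P_rel: "equiv (boundary_paths \<Lambda> \<times> {(m, n). m \<le> n}) (P_rel \<Lambda>)"
  by (rule equivI) (auto simp: P_rel_def refl_on_def sym_def trans_def)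

lemma equiv_class_eq_iff_rel:
  assumes "equiv A r" "a \<in> A"
  shows "r `` {a} = r `` {b} \<longleftrightarrow> (a, b) \<in> r"
proof
  assume "r `` {a} = r `` {b}"
  then have "(b, a) \<in> r" using equiv_class_self[OF assms] by blast
  then show "(a, b) \<in> r" using assms(1) by (blast elim: equivE dest: symD)
qed (rule equiv_class_eq[OF assms(1)])

lemma V_class_eq_iff:
  "x \<in> boundary_paths \<Lambda> \<Longrightarrow> V_class \<Lambda> x m = V_class \<Lambda> y n \<longleftrightarrow> ((x, m), (y, n)) \<in> V_rel \<Lambda>"
  by (rule equiv_class_eq_iff_rel[OF equiv_V_rel]) simp

lemma P_class_eq_iff:
  "x \<in> boundary_paths \<Lambda> \<Longrightarrow> m \<le> n
    \<Longrightarrow> P_class \<Lambda> x m n = P_class \<Lambda> y p q \<longleftrightarrow> ((x, m, n), (y, p, q)) \<in> P_rel \<Lambda>"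
  by (rule equiv_class_eq_iff_rel[OF equiv_P_rel]) simp

lemma P_rel_refl: "x \<in> boundary_paths \<Lambda> \<Longrightarrow> m \<le> n \<Longrightarrow> ((x, m, n), (x, m, n)) \<in> P_rel \<Lambda>"
  by (simp add: P_rel_iff)

lemma P_rel_sym: "(a, b) \<in> P_rel \<Lambda> \<Longrightarrow> (b, a) \<in> P_rel \<Lambda>"
  by (auto simp: P_rel_def)

lemma P_rel_trans: "(a, b) \<in> P_rel \<Lambda> \<Longrightarrow> (b, c) \<in> P_rel \<Lambda> \<Longrightarrow> (a, c) \<in> P_rel \<Lambda>"
  by (auto simp: P_rel_def)

lemma P_rel_deg:
  assumes "((x, m, n), (y, p, q)) \<in> P_rel \<Lambda>"
  shows "meet n (pdeg x) - meet m (pdeg x) = meet q (pdeg y) - meet p (pdeg y)"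
proof -
  have xy: "x \<in> boundary_paths \<Lambda>" "y \<in> boundary_paths \<Lambda>" "m \<le> n" "p \<le> q"
    and eq: "pmor x (meet m (pdeg x), meet n (pdeg x)) = pmor y (meet p (pdeg y), meet q (pdeg y))"
    using assms unfolding P_rel_iff by blast+
  show ?thesis
    using bp_deg[OF xy(1) meet_mono[OF xy(3)] meet_le] bp_deg[OF xy(2) meet_mono[OF xy(4)] meet_le] eq
    by simp
qed

text \<open>
  The source needs an argument: the definition of \<open>P_rel\<close> fixes the offset at the start only, but the
  offset at the end follows because equal paths of \<open>\<Lambda>\<close> have equal degrees.
\<close>

lemma P_rel_ends:
  assumes "((x, m, n), (y, p, q)) \<in> P_rel \<Lambda>"
  shows "((x, m), (y, p)) \<in> V_rel \<Lambda>" "((x, n), (y, q)) \<in> V_rel \<Lambda>"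
proof -
  have xy: "x \<in> boundary_paths \<Lambda>" "y \<in> boundary_paths \<Lambda>" "m \<le> n" "p \<le> q"
    and eq: "pmor x (meet m (pdeg x), meet n (pdeg x)) = pmor y (meet p (pdeg y), meet q (pdeg y))"
    and off: "m - meet m (pdeg x) = p - meet p (pdeg y)" and len: "n - m = q - p"
    using assms unfolding P_rel_iff by blast+
  note mx = meet_mono[OF xy(3)] and my = meet_mono[OF xy(4)]
  show "((x, m), (y, p)) \<in> V_rel \<Lambda>"
    unfolding V_rel_iff using xy off eq bp_rng[OF xy(1) mx meet_le] bp_rng[OF xy(2) my meet_le] by simp
  have "n - meet n (pdeg x) = q - meet q (pdeg y)"
    using meet_diff_cong(2)[OF xy(3) order_refl xy(4) len off P_rel_deg[OF assms]] len xy(4)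
    by (simp add: deg_add_diff)
  then show "((x, n), (y, q)) \<in> V_rel \<Lambda>"
    unfolding V_rel_iff using xy eq bp_src[OF xy(1) mx meet_le] bp_src[OF xy(2) my meet_le] by simp
qed

lemma P_rel_concat:
  assumes "((x, m, n), (y, p, q)) \<in> P_rel \<Lambda>" "((x, n, r), (y, q, s)) \<in> P_rel \<Lambda>"
  shows "((x, m, r), (y, p, s)) \<in> P_rel \<Lambda>"
proof -
  have xy: "x \<in> boundary_paths \<Lambda>" "y \<in> boundary_paths \<Lambda>" "m \<le> n" "n \<le> r" "p \<le> q" "q \<le> s"
    and len: "n - m = q - p" "r - n = s - q"
    using assms unfolding P_rel_iff by blast+
  have "r j - m j = s j - p j" for j
  proof -
    have "m j \<le> n j" "n j \<le> r j" "p j \<le> q j" "q j \<le> s j"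
      "n j - m j = q j - p j" "r j - n j = s j - q j"
      using xy len by (simp_all add: pointwise)
    then show ?thesis by linarith
  qed
  then have "r - m = s - p" by (simp add: fun_eq_iff)
  moreover have "pmor x (meet m (pdeg x), meet r (pdeg x)) = pmor y (meet p (pdeg y), meet s (pdeg y))"
    using assms bp_cmp[OF xy(1) meet_mono[OF xy(3)] meet_mono[OF xy(4)] meet_le]
      bp_cmp[OF xy(2) meet_mono[OF xy(5)] meet_mono[OF xy(6)] meet_le]
    unfolding P_rel_iff by metis
  ultimately show ?thesis
    using assms order_trans[OF xy(3,4)] order_trans[OF xy(5,6)] unfolding P_rel_iff by blast
qed


context k_graph
begin

text \<open>
  Equivalent representatives have equivalent subsegments. This is the source of unique factorisation
  in \<open>tilde \<Lambda>\<close>: once two factorisations are written with one boundary path each, they can be compared inside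
  equivalent representatives of the composite.
\<close>

lemma P_rel_segment:
  assumes rel: "((x, m, n), (y, p, q)) \<in> P_rel \<Lambda>" and ab: "m \<le> a" "a \<le> b" "b \<le> n"
  shows "((x, a, b), (y, p + (a - m), p + (b - m))) \<in> P_rel \<Lambda>"
proof -
  have xy: "x \<in> boundary_paths \<Lambda>" "y \<in> boundary_paths \<Lambda>" "m \<le> n" "p \<le> q"
    and eq: "pmor x (meet m (pdeg x), meet n (pdeg x)) = pmor y (meet p (pdeg y), meet q (pdeg y))"
    and off: "m - meet m (pdeg x) = p - meet p (pdeg y)" and len: "n - m = q - p"
    using rel unfolding P_rel_iff by blast+
  let ?a = "p + (a - m)" and ?b = "p + (b - m)"
  have bounds: "m \<le> b" "a \<le> n" using ab by auto
  have "p j \<le> ?a j \<and> ?a j \<le> ?b j \<and> ?b j \<le> q j \<and> b j - a j = ?b j - ?a j" for j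
  proof -
    have "m j \<le> a j" "a j \<le> b j" "b j \<le> n j" "p j \<le> q j" "n j - m j = q j - p j"
      using ab xy len by (simp_all add: pointwise)
    then show ?thesis by auto
  qed
  then have abp: "p \<le> ?a" "?a \<le> ?b" "?b \<le> q" "b - a = ?b - ?a"
    unfolding le_fun_def fun_eq_iff minus_apply by blast+
  note da = meet_diff_cong[OF ab(1) bounds(2) xy(4) len off P_rel_deg[OF rel]]
    and db = meet_diff_cong[OF bounds(1) ab(3) xy(4) len off P_rel_deg[OF rel]]
  have "meet b (pdeg x) j - meet a (pdeg x) j = meet ?b (pdeg y) j - meet ?a (pdeg y) j" for j
  proof -
    have "meet m (pdeg x) j \<le> meet a (pdeg x) j" "meet a (pdeg x) j \<le> meet b (pdeg x) j"
      "meet p (pdeg y) j \<le> meet ?a (pdeg y) j" "meet ?a (pdeg y) j \<le> meet ?b (pdeg y) j"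
      using meet_mono[OF ab(1)] meet_mono[OF ab(2)] meet_mono[OF abp(1)] meet_mono[OF abp(2)]
      unfolding le_fun_def by blast+
    moreover have "meet ?a (pdeg y) j - meet p (pdeg y) j = meet a (pdeg x) j - meet m (pdeg x) j"
      "meet ?b (pdeg y) j - meet p (pdeg y) j = meet b (pdeg x) j - meet m (pdeg x) j"
      using fun_cong[OF da(1), of j] fun_cong[OF db(1), of j] by (simp_all only: minus_apply)
    ultimately show ?thesis by linarith
  qed
  then have dab: "meet b (pdeg x) - meet a (pdeg x) = meet ?b (pdeg y) - meet ?a (pdeg y)"
    unfolding fun_eq_iff minus_apply by blast
  have "pmor x (meet a (pdeg x), meet b (pdeg x)) = pmor y (meet ?a (pdeg y), meet ?b (pdeg y))"
    by (rule bp_segment_eq[OF xy(1,2) meet_mono[OF ab(1)] meet_mono[OF ab(2)] meet_mono[OF ab(3)]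
          meet_le meet_mono[OF abp(1)] meet_mono[OF abp(2)] meet_mono[OF abp(3)] meet_le eq
          da(1)[symmetric] dab])
  then show ?thesis unfolding P_rel_iff using xy ab abp da(2) by blast
qed

end

section \<open>The structure maps of \<open>tilde \<Lambda>\<close> on classes\<close>

lemma V_class_Obj: "x \<in> boundary_paths \<Lambda> \<Longrightarrow> V_class \<Lambda> x m \<in> Obj (tilde \<Lambda>)"
  by (simp add: tilde_def quotientI)

lemma P_class_Mor: "x \<in> boundary_paths \<Lambda> \<Longrightarrow> m \<le> n \<Longrightarrow> P_class \<Lambda> x m n \<in> Mor (tilde \<Lambda>)"
  by (simp add: tilde_def quotientI)

lemma tilde_Obj_cases:
  assumes "v \<in> Obj (tilde \<Lambda>)"
  obtains x m where "x \<in> boundary_paths \<Lambda>" "v = V_class \<Lambda> x m"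
  using assms by (auto simp: tilde_def elim!: quotientE)

lemma tilde_Mor_cases:
  assumes "\<alpha> \<in> Mor (tilde \<Lambda>)"
  obtains x m n where "x \<in> boundary_paths \<Lambda>" "m \<le> n" "\<alpha> = P_class \<Lambda> x m n"
  using assms by (auto simp: tilde_def elim!: quotientE)

text \<open>
  Evaluation of the class-valued structure maps of \<open>tilde \<Lambda>\<close>, which are unions over representatives.
\<close>

lemma UN_pairs_const:
  assumes "a \<in> A" "\<And>x m. (x, m) \<in> A \<Longrightarrow> f x m = c"
  shows "(\<Union>(x, m)\<in>A. f x m) = c"
proof -
  have "(case b of (x, m) \<Rightarrow> f x m) = c" if "b \<in> A" for b using assms(2) that by (cases b) simp
  then show ?thesis using assms(1) by blast
qed

lemma UN_triples_const:
  assumes "a \<in> A" "\<And>x m n. (x, m, n) \<in> A \<Longrightarrow> f x m n = c"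
  shows "(\<Union>(x, m, n)\<in>A. f x m n) = c"
proof -
  have "(case b of (x, m, n) \<Rightarrow> f x m n) = c" if "b \<in> A" for b
    using assms(2) that by (cases b) simp
  then show ?thesis using assms(1) by blast
qed
lemma
  assumes x: "x \<in> boundary_paths \<Lambda>" and mn: "m \<le> n"
  shows rng_tilde: "rng (tilde \<Lambda>) (P_class \<Lambda> x m n) = V_class \<Lambda> x m"
    and src_tilde: "src (tilde \<Lambda>) (P_class \<Lambda> x m n) = V_class \<Lambda> x n"
    and deg_tilde: "deg (tilde \<Lambda>) (P_class \<Lambda> x m n) = n - m"
proof -
  have self: "(x, m, n) \<in> P_class \<Lambda> x m n" using P_rel_refl[OF x mn] by simp
  have same: "V_class \<Lambda> y p = V_class \<Lambda> x m \<and> V_class \<Lambda> y q = V_class \<Lambda> x n \<and> q - p = n - m"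
    if "(y, p, q) \<in> P_class \<Lambda> x m n" for y p q
  proof -
    have "((x, m, n), (y, p, q)) \<in> P_rel \<Lambda>" using that by simp
    then show ?thesis using P_rel_ends V_class_eq_iff[OF x] unfolding P_rel_iff by metis
  qed
  show "rng (tilde \<Lambda>) (P_class \<Lambda> x m n) = V_class \<Lambda> x m"
    "src (tilde \<Lambda>) (P_class \<Lambda> x m n) = V_class \<Lambda> x n"
    unfolding tilde_def graded_cat.select_convs
    by (rule UN_triples_const[OF self], use same in blast)+
  show "deg (tilde \<Lambda>) (P_class \<Lambda> x m n) = n - m"
    unfolding tilde_def graded_cat.select_convs
  proof (rule the_elem_image_unique)
    show "P_class \<Lambda> x m n \<noteq> {}" using self by blast
  qed (use same in auto)
qed

lemma idt_tilde:
  assumes x: "x \<in> boundary_paths \<Lambda>"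
  shows "idt (tilde \<Lambda>) (V_class \<Lambda> x m) = P_class \<Lambda> x m m"
proof -
  have self: "(x, m) \<in> V_class \<Lambda> x m" using x by (simp add: V_rel_iff)
  have "P_class \<Lambda> y p p = P_class \<Lambda> x m m" if "(y, p) \<in> V_class \<Lambda> x m" for y p
  proof -
    have "((x, m), (y, p)) \<in> V_rel \<Lambda>" using that by simp
    moreover from this have "pmor x (meet m (pdeg x), meet m (pdeg x))
        = pmor y (meet p (pdeg y), meet p (pdeg y))"
      using bp_idt[OF x meet_le] bp_idt[of y \<Lambda>, OF _ meet_le] unfolding V_rel_iff by metis
    moreover have "m - m = p - p" by (simp add: fun_eq_iff)
    ultimately have "((x, m, m), (y, p, p)) \<in> P_rel \<Lambda>"
      unfolding V_rel_iff P_rel_iff by blast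
    then show ?thesis unfolding P_class_eq_iff[OF x order_refl, symmetric] by (rule sym)
  qed
  then show ?thesis
    unfolding tilde_def graded_cat.select_convs
    by (rule UN_pairs_const[OF self])
qed

section \<open>Vertices of \<open>tilde \<Lambda>\<close> and the absence of sources\<close>

lemma proj_ob_class:
  assumes x: "x \<in> boundary_paths \<Lambda>"
  shows "proj_ob (V_class \<Lambda> x m) = pob x (meet m (pdeg x))"
proof -
  have self: "(x, m) \<in> V_class \<Lambda> x m" using x by (simp add: V_rel_iff)
  show ?thesis
    unfolding proj_ob_def
  proof (rule the_elem_image_unique)
    show "V_class \<Lambda> x m \<noteq> {}" using self by blast
  qed (auto simp: V_rel_iff)
qed

lemma no_edge_deg_zero:
  assumes x: "x \<in> boundary_paths \<Lambda>" and e: "paths_of \<Lambda> (pob x 0) (unit_deg i) = {}"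
  shows "pdeg x i = 0"
proof (rule ccontr)
  assume "pdeg x i \<noteq> 0"
  then have "to_edeg (unit_deg i) \<le> pdeg x"
    by (auto simp: to_edeg_le_iff unit_deg_def zero_enat_def[symmetric] Suc_ile_eq)
  then have "pmor x (0, unit_deg i) \<in> paths_of \<Lambda> (pob x 0) (unit_deg i)"
    using x zero_le_deg unfolding paths_of_def
    by (simp add: bp_Mor bp_rng bp_deg)
  then show False using e by simp
qed

text \<open>
  Discarding the part of \<open>x\<close> before \<open>m\<close> normalises a representative: the new starting index is the
  offset of the vertex.
\<close>

lemma P_rel_shift:
  assumes x: "x \<in> boundary_paths \<Lambda>" and mn: "m \<le> n"
  shows "((x, m, n), (shift (meet m (pdeg x)) x, m - meet m (pdeg x), n - meet m (pdeg x))) \<in> P_rel \<Lambda>"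
proof -
  let ?d = "pdeg x" and ?p = "meet m (pdeg x)"
  let ?e = "?d - to_edeg ?p"
  have coord: "meet (m - ?p) ?e i = 0 \<and> meet (n - ?p) ?e i + ?p i = meet n ?d i
      \<and> (n - ?p) i - (m - ?p) i = n i - m i \<and> (m - ?p) i \<le> (n - ?p) i" for i
    using mn[unfolded le_fun_def, rule_format, of i]
    by (cases "?d i") (auto simp: meet_apply to_edeg_def min_def)
  then have 1: "meet (m - ?p) ?e = 0" and 2: "meet (n - ?p) ?e + ?p = meet n ?d"
    and 3: "n - ?p - (m - ?p) = n - m" and 4: "m - ?p \<le> n - ?p"
    by (simp_all add: pointwise)
  have "pmor (shift ?p x) (0, meet (n - ?p) ?e) = pmor x (?p, meet n ?d)"
    using pmor_shift[OF meet_le[of m ?d] zero_le_deg, of "meet (n - ?p) ?e"] 2 meet_le[of n ?d] by simp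
  then show ?thesis
    unfolding P_rel_iff pdeg_shift using x mn shift_bp[OF x meet_le] 1 3 4 by simp
qed

text \<open>
  A vertex \<open>v\<close> of \<open>tilde \<Lambda>\<close> is determined by \<open>proj_ob v\<close> and its offset \<open>t\<close>, which records how far \<open>v\<close> lies
  outside \<open>\<Lambda>\<close>. The point of the second clause is that \<open>t\<close> is positive only in directions in which
  boundary paths at \<open>proj_ob v\<close> cannot move. Thus any of them can represent \<open>v\<close> with the same index
  \<open>t\<close>, and normalised representatives of the paths starting at \<open>v\<close> all start at \<open>t\<close>.
\<close>

lemma tilde_vertex_offset:
  assumes "v \<in> Obj (tilde \<Lambda>)"
  obtains t where
    "\<And>x. x \<in> boundary_paths \<Lambda> \<Longrightarrow> pob x 0 = proj_ob v \<Longrightarrow> V_class \<Lambda> x t = v"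
    "\<And>x. x \<in> boundary_paths \<Lambda> \<Longrightarrow> pob x 0 = proj_ob v
      \<Longrightarrow> \<forall>i. t i \<noteq> 0 \<longrightarrow> pdeg x i = 0"
    "\<And>\<alpha>. \<alpha> \<in> Mor (tilde \<Lambda>) \<Longrightarrow> rng (tilde \<Lambda>) \<alpha> = v \<Longrightarrow>
       \<exists>x \<in> boundary_paths \<Lambda>. pob x 0 = proj_ob v \<and> \<alpha> = P_class \<Lambda> x t (t + deg (tilde \<Lambda>) \<alpha>)"
proof -
  obtain y p where y: "y \<in> boundary_paths \<Lambda>" and v: "v = V_class \<Lambda> y p"
    using assms by (rule tilde_Obj_cases)
  define t where "t = p - meet p (pdeg y)"
  have pv: "proj_ob v = pob y (meet p (pdeg y))" using y v by (simp add: proj_ob_class)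
  have zero: "pdeg x i = 0" if x: "x \<in> boundary_paths \<Lambda>" "pob x 0 = proj_ob v" and i: "t i \<noteq> 0" for x i
  proof -
    \<comment> \<open>A positive offset means that \<open>y\<close> ended in this direction before \<open>p\<close>.\<close>
    have "enat (meet p (pdeg y) i) = pdeg y i"
      using i by (cases "pdeg y i") (auto simp: t_def meet_apply min_def split: if_splits)
    then have "paths_of \<Lambda> (pob x 0) (unit_deg i) = {}"
      using bp_maximal[OF y meet_le] x pv by simp
    then show ?thesis by (rule no_edge_deg_zero[OF x(1)])
  qed
  have "V_class \<Lambda> x t = v" if x: "x \<in> boundary_paths \<Lambda>" "pob x 0 = proj_ob v" for x
  proof -
    have "meet t (pdeg x) i = 0" for i
      using zero[OF x, of i] by (cases "t i = 0"; cases "pdeg x i") (auto simp: meet_apply zero_enat_def)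
    then have "meet t (pdeg x) = 0" by (simp add: fun_eq_iff)
    moreover have "t - 0 = t" by (simp add: fun_eq_iff)
    ultimately have "((x, t), (y, p)) \<in> V_rel \<Lambda>"
      unfolding V_rel_iff using x y pv t_def by simp
    then show ?thesis using V_class_eq_iff[OF x(1)] v by simp
  qed
  moreover have "\<exists>x \<in> boundary_paths \<Lambda>. pob x 0 = proj_ob v \<and> \<alpha> = P_class \<Lambda> x t (t + deg (tilde \<Lambda>) \<alpha>)"
    if \<alpha>: "\<alpha> \<in> Mor (tilde \<Lambda>)" "rng (tilde \<Lambda>) \<alpha> = v" for \<alpha>
  proof -
    obtain z a b where z: "z \<in> boundary_paths \<Lambda>" "a \<le> b" "\<alpha> = P_class \<Lambda> z a b"
      using \<alpha>(1) by (rule tilde_Mor_cases)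
    have "((z, a), (y, p)) \<in> V_rel \<Lambda>"
      using \<alpha>(2) z v by (simp add: rng_tilde V_class_eq_iff)
    then have za: "a - meet a (pdeg z) = t" "pob z (meet a (pdeg z)) = proj_ob v"
      unfolding V_rel_iff t_def pv by blast+
    let ?x = "shift (meet a (pdeg z)) z"
    have "pob ?x 0 = proj_ob v" using za(2) by (simp add: pob_shift meet_le)
    moreover have "b - meet a (pdeg z) = t + (b - a)"
    proof
      fix i
      have "meet a (pdeg z) i \<le> a i" by (rule meet_le_arg)
      then show "(b - meet a (pdeg z)) i = (t + (b - a)) i"
        using z(2)[unfolded le_fun_def, rule_format, of i] by (simp add: za(1)[symmetric])
    qed
    ultimately show ?thesis
      using P_rel_shift[OF z(1,2)] P_class_eq_iff[OF z(1,2)] shift_bp[OF z(1) meet_le] z za(1)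
      by (intro bexI[of _ ?x]) (simp_all add: deg_tilde)
  qed
  ultimately show ?thesis using that zero by metis
qed

text \<open>
  A path in \<open>tilde \<Lambda>\<close> can always continue past the end of a representing boundary path, so the boundary
  condition rules out finite coordinates.
\<close>

lemma tilde_path_infinite:
  assumes w: "w \<in> boundary_paths (tilde \<Lambda>)"
  shows "pdeg w = (\<lambda>_. \<infinity>)"
proof
  fix i
  show "pdeg w i = \<infinity>"
  proof (rule ccontr)
    assume "pdeg w i \<noteq> \<infinity>"
    then obtain e where e: "pdeg w i = enat e" by auto
    define p where "p = (\<lambda>j. if j = i then e else 0)"
    have p: "to_edeg p \<le> pdeg w" using e by (simp add: to_edeg_le_iff p_def zero_enat_def[symmetric])
    obtain x m where x: "x \<in> boundary_paths \<Lambda>" "pob w p = V_class \<Lambda> x m"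
      using bp_Obj[OF w p] by (rule tilde_Obj_cases)
    have "m \<le> m + unit_deg i" "m + unit_deg i - m = unit_deg i" by (simp_all add: pointwise)
    then have "P_class \<Lambda> x m (m + unit_deg i) \<in> paths_of (tilde \<Lambda>) (pob w p) (unit_deg i)"
      using x by (simp add: paths_of_def P_class_Mor rng_tilde deg_tilde)
    then show False using bp_maximal[OF w p, of i] e by (auto simp: p_def)
  qed
qed

section \<open>Composition in \<open>tilde \<Lambda>\<close> through common representatives\<close>

context locally_convex_k_graph
begin

text \<open>
  The path in Farthing's formula for the composite follows \<open>x\<close> up to \<open>n\<close> and then \<open>y\<close> from \<open>p\<close> on. It
  therefore represents not only the composite but both factors. By \<open>rel\<close> the two pieces meet in \<open>\<Lambda>\<close> and
  have equal offsets, as needed for \<open>meet_concat\<close>.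
\<close>

lemma prepend_represents_both:
  assumes rel: "((x, n), (y, p)) \<in> V_rel \<Lambda>" and mn: "m \<le> n" and pq: "p \<le> q"
    and z: "z = prepend \<Lambda> (pmor x (0, meet n (pdeg x))) (shift (meet p (pdeg y)) y)"
  shows "((z, m, n), (x, m, n)) \<in> P_rel \<Lambda>" "((z, n, n + q - p), (y, p, q)) \<in> P_rel \<Lambda>"
proof -
  have xy: "x \<in> boundary_paths \<Lambda>" "y \<in> boundary_paths \<Lambda>"
    and ob: "pob x (meet n (pdeg x)) = pob y (meet p (pdeg y))"
    and off: "n - meet n (pdeg x) = p - meet p (pdeg y)"
    using rel unfolding V_rel_iff by blast+
  define f where "f = pmor x (0, meet n (pdeg x))"
  define s where "s = shift (meet p (pdeg y)) y"
  have s: "s \<in> boundary_paths \<Lambda>" unfolding s_def by (rule shift_bp[OF xy(2) meet_le])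
  have f: "f \<in> Mor \<Lambda>" "src \<Lambda> f = pob s 0" "deg \<Lambda> f = meet n (pdeg x)"
    unfolding f_def s_def using xy ob
    by (simp_all add: bp_Mor bp_src bp_deg zero_le_deg meet_le pob_shift)
  have zfs: "z = prepend \<Lambda> f s" by (simp add: z f_def s_def)
  note z_props = prepend_bp[OF f(1) s f(2), folded zfs] pdeg_prepend[OF f(1) s f(2), folded zfs]
    pmor_prepend[OF f(1) s f(2), folded zfs] shift_prepend[OF f(1) s f(2), folded zfs]
  have D: "pdeg z = to_edeg (meet n (pdeg x)) + (pdeg y - to_edeg (meet p (pdeg y)))"
    using z_props(2) f(3) by (simp add: s_def pdeg_shift)
  note meets = meet_concat[OF off D]
  note n_meet = meets(1)[OF order_refl] and m_meet = meets(1)[OF mn] and q_meet = meets(2)[OF pq]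
  have le: "to_edeg (meet n (pdeg x)) \<le> pdeg z" using meet_le[of n "pdeg z"] n_meet by simp
  have "pmor z (meet m (pdeg x), meet n (pdeg x)) = pmor x (meet m (pdeg x), meet n (pdeg x))"
    by (rule bp_segment_eq[OF z_props(1) xy(1) zero_le_deg meet_mono[OF mn] order_refl le
          zero_le_deg meet_mono[OF mn] order_refl meet_le])
      (use z_props(3) f(3) f_def in simp_all)
  then show "((z, m, n), (x, m, n)) \<in> P_rel \<Lambda>"
    unfolding P_rel_iff using z_props(1) xy mn n_meet m_meet by simp
  have nqp: "n + q - p = n + (q - p)" using pq by (auto simp: pointwise)
  then have nle: "n \<le> n + q - p" by (simp add: le_fun_def)
  let ?l = "meet q (pdeg y) - meet p (pdeg y)"
  have q_eq: "?l + meet p (pdeg y) = meet q (pdeg y)"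
    using meet_mono[OF pq] by (rule deg_diff_add)
  have r_eq: "?l + meet n (pdeg x) = meet (n + q - p) (pdeg z)"
    unfolding q_meet[symmetric] nqp[symmetric]
    using meet_mono[OF nle, of "pdeg z"] unfolding n_meet by (rule deg_diff_add)
  have "pmor z (meet n (pdeg x), meet (n + q - p) (pdeg z)) = pmor s (0, ?l)"
    using pmor_shift[OF le zero_le_deg, of ?l] z_props(4) f(3) r_eq
      meet_le[of "n + q - p" "pdeg z"] by simp
  also have "\<dots> = pmor y (meet p (pdeg y), meet q (pdeg y))"
    unfolding s_def using pmor_shift[OF meet_le[of p "pdeg y"] zero_le_deg, of ?l] q_eq meet_le[of q "pdeg y"]
    by simp
  finally show "((z, n, n + q - p), (y, p, q)) \<in> P_rel \<Lambda>"
    unfolding P_rel_iff using z_props(1) xy pq nle off n_meet nqp by simp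
qed

text \<open>
  The definition of the composite ranges over all pairs of representatives; each of them leads to a
  common representative of the two factors, and by \<open>P_rel_concat\<close> all of these give the same class.
\<close>

lemma cmp_tilde:
  assumes x: "x \<in> boundary_paths \<Lambda>" and mn: "m \<le> n" and nr: "n \<le> r"
  shows "cmp (tilde \<Lambda>) (P_class \<Lambda> x m n) (P_class \<Lambda> x n r) = P_class \<Lambda> x m r"
proof -
  have self: "(x, m, n) \<in> P_class \<Lambda> x m n" "(x, n, r) \<in> P_class \<Lambda> x n r"
    using P_rel_refl[OF x] mn nr by simp_all
  have "P_class \<Lambda> (prepend \<Lambda> (pmor x' (0, meet n' (pdeg x'))) (shift (meet p (pdeg y)) y)) m' (n' + q - p)
      = P_class \<Lambda> x m r" (is "P_class \<Lambda> ?z _ _ = _")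
    if "(x', m', n') \<in> P_class \<Lambda> x m n" "(y, p, q) \<in> P_class \<Lambda> x n r" for x' m' n' y p q
  proof -
    have rel: "((x, m, n), (x', m', n')) \<in> P_rel \<Lambda>" "((x, n, r), (y, p, q)) \<in> P_rel \<Lambda>"
      using that by simp_all
    then have le: "m' \<le> n'" "p \<le> q" unfolding P_rel_iff by blast+
    have V: "((x', n'), (y, p)) \<in> V_rel \<Lambda>"
      using P_rel_ends(2)[OF rel(1)] P_rel_ends(1)[OF rel(2)] unfolding V_rel_iff by simp
    note z = prepend_represents_both[OF V le refl]
    have "((x, m, r), (?z, m', n' + q - p)) \<in> P_rel \<Lambda>"
      using P_rel_concat[OF P_rel_trans[OF rel(1) P_rel_sym[OF z(1)]]
          P_rel_trans[OF rel(2) P_rel_sym[OF z(2)]]] .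
    then show ?thesis unfolding P_class_eq_iff[OF x order_trans[OF mn nr], symmetric] by (rule sym)
  qed
  then show ?thesis
    unfolding tilde_def graded_cat.select_convs
    by (intro UN_triples_const[OF self(1)] UN_triples_const[OF self(2)])
qed

lemma common_representative:
  assumes "\<alpha> \<in> Mor (tilde \<Lambda>)" "\<beta> \<in> Mor (tilde \<Lambda>)" "src (tilde \<Lambda>) \<alpha> = rng (tilde \<Lambda>) \<beta>"
  obtains z m n r where "z \<in> boundary_paths \<Lambda>" "m \<le> n" "n \<le> r"
    "\<alpha> = P_class \<Lambda> z m n" "\<beta> = P_class \<Lambda> z n r"
proof -
  obtain x m n where x: "x \<in> boundary_paths \<Lambda>" "m \<le> n" "\<alpha> = P_class \<Lambda> x m n"
    using assms(1) by (rule tilde_Mor_cases)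
  obtain y p q where y: "y \<in> boundary_paths \<Lambda>" "p \<le> q" "\<beta> = P_class \<Lambda> y p q"
    using assms(2) by (rule tilde_Mor_cases)
  have V: "((x, n), (y, p)) \<in> V_rel \<Lambda>"
    using assms(3) x y by (simp add: rng_tilde src_tilde V_class_eq_iff)
  note z = prepend_represents_both[OF V x(2) y(2) refl]
  then have zb: "prepend \<Lambda> (pmor x (0, meet n (pdeg x))) (shift (meet p (pdeg y)) y) \<in> boundary_paths \<Lambda>"
    "n \<le> n + q - p"
    unfolding P_rel_iff by blast+
  have "\<alpha> = P_class \<Lambda> (prepend \<Lambda> (pmor x (0, meet n (pdeg x))) (shift (meet p (pdeg y)) y)) m n"
    using z(1) unfolding x(3) P_class_eq_iff[OF zb(1) x(2), symmetric] by (rule sym)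
  moreover have "\<beta> = P_class \<Lambda> (prepend \<Lambda> (pmor x (0, meet n (pdeg x)))
      (shift (meet p (pdeg y)) y)) n (n + q - p)"
    using z(2) unfolding y(3) P_class_eq_iff[OF zb, symmetric] by (rule sym)
  ultimately show ?thesis by (rule that[OF zb(1) x(2) zb(2)])
qed

text \<open>
  Unique factorisation in \<open>tilde \<Lambda>\<close>: a composite that is represented by \<open>x\<close> has its factors represented by the
  subsegments of \<open>x\<close>, because the common representative of the factors can be compared with \<open>x\<close>
  through the composite.
\<close>

lemma split_tilde:
  assumes \<alpha>: "\<alpha> \<in> Mor (tilde \<Lambda>)" and \<beta>: "\<beta> \<in> Mor (tilde \<Lambda>)"
    and c: "src (tilde \<Lambda>) \<alpha> = rng (tilde \<Lambda>) \<beta>" "cmp (tilde \<Lambda>) \<alpha> \<beta> = P_class \<Lambda> x m r"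
    and x: "x \<in> boundary_paths \<Lambda>" and mn: "m \<le> n" and nr: "n \<le> r"
    and d: "deg (tilde \<Lambda>) \<alpha> = n - m"
  shows "\<alpha> = P_class \<Lambda> x m n" "\<beta> = P_class \<Lambda> x n r"
proof -
  obtain z p q s where z: "z \<in> boundary_paths \<Lambda>" "p \<le> q" "q \<le> s"
    "\<alpha> = P_class \<Lambda> z p q" "\<beta> = P_class \<Lambda> z q s"
    using common_representative[OF \<alpha> \<beta> c(1)] .
  have ps: "p \<le> s" using z order_trans by blast
  have "P_class \<Lambda> z p s = P_class \<Lambda> x m r" using c(2) z cmp_tilde by simp
  then have rel: "((z, p, s), (x, m, r)) \<in> P_rel \<Lambda>" using P_class_eq_iff[OF z(1) ps] by simp
  then have "s - p = r - m" unfolding P_rel_iff by blast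
  then have "m + (s - p) = r" using order_trans[OF mn nr] by (simp add: deg_add_diff)
  moreover have "m + (q - p) = n" using d z mn by (simp add: deg_tilde deg_add_diff)
  moreover have "m + (p - p) = m" by (simp add: fun_eq_iff)
  ultimately have "((z, p, q), (x, m, n)) \<in> P_rel \<Lambda>" "((z, q, s), (x, n, r)) \<in> P_rel \<Lambda>"
    using P_rel_segment[OF rel order_refl z(2,3)] P_rel_segment[OF rel z(2,3) order_refl] by simp_all
  then show "\<alpha> = P_class \<Lambda> x m n" "\<beta> = P_class \<Lambda> x n r"
    using z(4,5) P_class_eq_iff[OF z(1,2)] P_class_eq_iff[OF z(1,3)] by simp_all
qed

section \<open>Infinite paths of \<open>tilde \<Lambda>\<close>\<close>

text \<open>
  Splitting \<open>w(0, l)\<close> first at \<open>a\<close> and then at \<open>b\<close>.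
\<close>

lemma tilde_path_segment:
  assumes w: "w \<in> boundary_paths (tilde \<Lambda>)" and x: "x \<in> boundary_paths \<Lambda>"
    and ini: "pmor w (0, l) = P_class \<Lambda> x t (t + l)" and ab: "a \<le> b" "b \<le> l"
  shows "pmor w (a, b) = P_class \<Lambda> x (t + a) (t + b)"
proof -
  have inf: "to_edeg p \<le> pdeg w" for p by (simp add: tilde_path_infinite[OF w] to_edeg_le_iff)
  note w_simps = bp_Mor[OF w _ inf] bp_rng[OF w _ inf] bp_src[OF w _ inf] bp_deg[OF w _ inf]
    bp_cmp[OF w _ _ inf]
  have al: "a \<le> l" using ab by simp
  have t: "t \<le> t + a" "t + a \<le> t + l" "t + a \<le> t + b" "t + b \<le> t + l" "t + a - t = a - 0"
    "t + b - (t + a) = b - a"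
    using ab al by (auto simp: pointwise)
  have "pmor w (a, l) = P_class \<Lambda> x (t + a) (t + l)"
    by (rule split_tilde(2)[of "pmor w (0, a)" _ x t "t + l" "t + a"])
      (use ini al t x in \<open>simp_all add: w_simps zero_le_deg\<close>)
  then show ?thesis
    by (intro split_tilde(1)[of "pmor w (a, b)" "pmor w (b, l)" x "t + a" "t + l" "t + b"])
      (use ab t x in \<open>simp_all add: w_simps\<close>)
qed

text \<open>
  The infinite path of \<open>tilde \<Lambda>\<close> that runs along \<open>x\<close> and beyond its end, starting at \<open>[x; t]\<close>.
\<close>

definition lift :: "('o, 'm, 'k) path \<Rightarrow> 'k deg
    \<Rightarrow> (('o, 'm, 'k) tilde_ob, ('o, 'm, 'k) tilde_mor, 'k) path" where
  "lift x t = \<lparr>pdeg = (\<lambda>_. \<infinity>), pob = (\<lambda>p. V_class \<Lambda> x (t + p)),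
     pmor = restrict (\<lambda>(p, q). P_class \<Lambda> x (t + p) (t + q)) (Mor (Omega (\<lambda>_. \<infinity>)))\<rparr>"

lemma
  shows pdeg_lift: "pdeg (lift x t) = (\<lambda>_. \<infinity>)"
    and pob_lift: "pob (lift x t) p = V_class \<Lambda> x (t + p)"
    and pmor_lift: "p \<le> q \<Longrightarrow> pmor (lift x t) (p, q) = P_class \<Lambda> x (t + p) (t + q)"
  by (simp_all add: lift_def Omega_def to_edeg_le_iff)

lemma lift_bp:
  assumes x: "x \<in> boundary_paths \<Lambda>"
  shows "lift x t \<in> boundary_paths (tilde \<Lambda>)"
proof -
  have le: "t + p \<le> t + q" if "p \<le> q" for p q using that by (simp add: le_fun_def)
  have diff: "t + q - (t + p) = q - p" for p q by (simp add: fun_eq_iff)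
  have "degree_functor (Omega (\<lambda>_. \<infinity>)) (tilde \<Lambda>) (pob (lift x t)) (pmor (lift x t))"
    unfolding Omega_functor_iff
  proof (intro conjI allI impI; (elim conjE)?)
    fix p q r :: "'k deg" assume "p \<le> q" "q \<le> r"
    then show "pmor (lift x t) (p, r)
        = cmp (tilde \<Lambda>) (pmor (lift x t) (p, q)) (pmor (lift x t) (q, r))"
      using order_trans[of p q r] by (simp add: pmor_lift cmp_tilde x le)
  qed (simp_all add: pob_lift pmor_lift V_class_Obj P_class_Mor rng_tilde src_tilde deg_tilde
      idt_tilde x le diff)
  moreover have "pob (lift x t) \<in> extensional (Obj (Omega (pdeg (lift x t))))"
    by (simp add: pdeg_lift Omega_def to_edeg_le_iff extensional_def)
  moreover have "pmor (lift x t) \<in> extensional (Mor (Omega (pdeg (lift x t))))"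
    by (simp add: lift_def)
  ultimately show ?thesis unfolding boundary_paths_def by (simp add: pdeg_lift)
qed

end

section \<open>Local periodicity\<close>

text \<open>
  Beyond \<open>t + m\<close> the representative \<open>x\<close> only shows its shift by \<open>m \<and> d(x)\<close>. Together with \<open>offset_add\<close>
  this means that the class of \<open>(x; (t + m + a, t + m + b))\<close> depends on \<open>m\<close> only through that shift
  and the offset of \<open>m\<close>.
\<close>

lemma pmor_add:
  assumes t: "\<forall>i. t i \<noteq> 0 \<longrightarrow> pdeg x i = 0" and ab: "a \<le> b"
  defines "d \<equiv> pdeg x"
  shows "pmor x (meet (t + (m + a)) d, meet (t + (m + b)) d)
      = pmor (shift (meet m d) x) (meet a (d - to_edeg (meet m d)), meet b (d - to_edeg (meet m d)))"
proof -
  note meets = meet_add[of t d m, OF t[folded d_def]]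
  have "to_edeg (meet b (d - to_edeg (meet m d)) + meet m d) \<le> pdeg x"
    using meet_le[of "t + (m + b)" d, unfolded meets] by (simp add: d_def add.commute)
  then show ?thesis
    unfolding meets using meet_mono[OF ab] meet_le[of m "pdeg x"]
    by (simp add: pmor_shift d_def add.commute)
qed

text \<open>
  From left to right the classes agree by \<open>pmor_add\<close> and \<open>offset_add\<close>. From right to left, the offsets of the
  starting points at \<open>a = 0\<close> give \<open>m - m \<and> d(x) = n - n \<and> d(x)\<close>. Cancelling this from the offsets for
  general \<open>a\<close> shows that the degrees of the two shifts of \<open>x\<close> have the same truncations at every \<open>a\<close>, hence coincide,
  and their segments then agree since indices within the degree are not truncated.
\<close>

lemma periodic_iff:
  fixes \<Lambda> :: "('o, 'm, 'k::finite) graded_cat"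
  assumes x: "x \<in> boundary_paths \<Lambda>" and t: "\<forall>i. t i \<noteq> 0 \<longrightarrow> pdeg x i = 0"
  shows "m - meet m (pdeg x) = n - meet n (pdeg x)
        \<and> shift (meet m (pdeg x)) x = shift (meet n (pdeg x)) x
    \<longleftrightarrow> (\<forall>a b. a \<le> b \<longrightarrow>
          P_class \<Lambda> x (t + (m + a)) (t + (m + b)) = P_class \<Lambda> x (t + (n + a)) (t + (n + b)))"
    (is "?off \<and> ?shift \<longleftrightarrow> (\<forall>a b. a \<le> b \<longrightarrow> ?eq a b)")
proof -
  define d where "d = pdeg x"
  define e where "e = (\<lambda>m. d - to_edeg (meet m d))"
  define s where "s = (\<lambda>m. shift (meet m d) x)"
  have s: "s m \<in> boundary_paths \<Lambda>" "pdeg (s m) = e m" for m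
    unfolding s_def e_def d_def using shift_bp[OF x meet_le] by (simp_all add: pdeg_shift)
  note beyond = offset_add[OF t, folded d_def] pmor_add[OF t, folded d_def]
  have eq_iff: "?eq a b \<longleftrightarrow>
      pmor (s m) (meet a (e m), meet b (e m)) = pmor (s n) (meet a (e n), meet b (e n))
      \<and> t + (m - meet m d) + (a - meet a (e m)) = t + (n - meet n d) + (a - meet a (e n))"
    if ab: "a \<le> b" for a b
  proof -
    have le: "t + (l + a) \<le> t + (l + b)" for l using ab by (simp add: le_fun_def)
    have "t + (m + b) - (t + (m + a)) = t + (n + b) - (t + (n + a))" by (simp add: fun_eq_iff)
    then show ?thesis
      unfolding P_class_eq_iff[OF x le] P_rel_iff d_def[symmetric] beyond(1) beyond(2)[OF ab] s_def e_def
      using x le by blast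
  qed
  show ?thesis
  proof
    assume per: "?off \<and> ?shift"
    then have "s m = s n" by (simp add: s_def d_def)
    moreover from this have "e m = e n" using s(2) by metis
    ultimately show "\<forall>a b. a \<le> b \<longrightarrow> ?eq a b" using eq_iff per by (simp add: d_def)
  next
    assume all: "\<forall>a b. a \<le> b \<longrightarrow> ?eq a b"
    have mor: "pmor (s m) (meet a (e m), meet b (e m)) = pmor (s n) (meet a (e n), meet b (e n))"
      if "a \<le> b" for a b using all eq_iff that by blast
    have off: "t + (m - meet m d) + (a - meet a (e m)) = t + (n - meet n d) + (a - meet a (e n))" for a
      using eq_iff[OF order_refl[of a]] all[rule_format, OF order_refl[of a]] by blast
    have "meet 0 e = 0" for e :: "'k edeg" by (simp add: fun_eq_iff meet_apply split: enat.split)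
    then have off_mn: "m - meet m d = n - meet n d" using off[of 0] by (simp add: fun_eq_iff)
    then have "a - meet a (e m) = a - meet a (e n)" for a using off[of a] by simp
    then have "a i - meet a (e m) i = a i - meet a (e n) i" for a i by (metis minus_apply)
    then have "meet a (e m) i = meet a (e n) i" for a i
      using meet_le_arg by (metis diff_diff_cancel)
    then have e_mn: "e m = e n" by (intro edeg_eqI ext)
    have "s m = s n"
    proof (rule bp_ext[OF s(1) s(1)])
      show "pdeg (s m) = pdeg (s n)" by (simp add: s(2) e_mn)
      fix p q assume pq: "p \<le> q" "to_edeg q \<le> pdeg (s m)"
      then have "meet p (e n) = p" "meet q (e n) = q"
        using to_edeg_le_mono by (auto simp: s(2) e_mn intro: meet_absorb)
      then show "pmor (s m) (p, q) = pmor (s n) (p, q)" using mor[OF pq(1)] by (simp add: e_mn)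
    qed
    then show "?off \<and> ?shift" using off_mn by (simp add: s_def d_def)
  qed
qed

context locally_convex_k_graph
begin

text \<open>
  For one direction \<open>periodic_iff\<close> is applied to \<open>x\<close> and its lift, for the other to a boundary path that
  represents a sufficiently long initial segment of a given infinite path.
\<close>

theorem local_periodicity_tilde_iff:
  assumes v: "v \<in> Obj (tilde \<Lambda>)"
  shows "local_periodicity (tilde \<Lambda>) m n v \<longleftrightarrow> local_periodicity \<Lambda> m n (proj_ob v)"
proof -
  obtain t where
    t_class: "\<And>x. x \<in> boundary_paths \<Lambda> \<Longrightarrow> pob x 0 = proj_ob v \<Longrightarrow> V_class \<Lambda> x t = v" and
    t_zero: "\<And>x. x \<in> boundary_paths \<Lambda> \<Longrightarrow> pob x 0 = proj_ob v
      \<Longrightarrow> \<forall>i. t i \<noteq> 0 \<longrightarrow> pdeg x i = 0" and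
    t_mor: "\<And>\<alpha>. \<alpha> \<in> Mor (tilde \<Lambda>) \<Longrightarrow> rng (tilde \<Lambda>) \<alpha> = v \<Longrightarrow>
       \<exists>x \<in> boundary_paths \<Lambda>. pob x 0 = proj_ob v \<and> \<alpha> = P_class \<Lambda> x t (t + deg (tilde \<Lambda>) \<alpha>)"
    using tilde_vertex_offset[OF v] by blast
  have inf: "to_edeg p \<le> pdeg w" if "w \<in> boundary_paths (tilde \<Lambda>)" for w and p :: "'k deg"
    using tilde_path_infinite[OF that] by (simp add: to_edeg_le_iff)
  show ?thesis
  proof
    assume L: "local_periodicity (tilde \<Lambda>) m n v"
    show "local_periodicity \<Lambda> m n (proj_ob v)"
      unfolding local_periodicity_def
    proof (intro ballI impI)
      fix x assume x: "x \<in> boundary_paths \<Lambda>" "pob x 0 = proj_ob v"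
      let ?w = "lift x t"
      have w: "?w \<in> boundary_paths (tilde \<Lambda>)" by (rule lift_bp[OF x(1)])
      have "pob ?w 0 = v" using t_class[OF x] by (simp add: pob_lift)
      then have sh: "shift m ?w = shift n ?w"
        using conjunct2[OF L[unfolded local_periodicity_def, rule_format, OF w]]
        by (simp only: pdeg_lift meet_infinity)
      have "P_class \<Lambda> x (t + (m + a)) (t + (m + b)) = P_class \<Lambda> x (t + (n + a)) (t + (n + b))"
        if ab: "a \<le> b" for a b
      proof -
        have "a + l \<le> b + l" for l using ab by (simp add: le_fun_def)
        then have "pmor (shift l ?w) (a, b) = P_class \<Lambda> x (t + (l + a)) (t + (l + b))" for l
          using ab inf[OF w] by (simp add: pmor_shift pmor_lift add.commute)
        then show ?thesis using sh by metis
      qed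
      then show "m - meet m (pdeg x) = n - meet n (pdeg x)
          \<and> shift (meet m (pdeg x)) x = shift (meet n (pdeg x)) x"
        by (intro periodic_iff[OF x(1) t_zero[OF x], THEN iffD2] allI impI)
    qed
  next
    assume R: "local_periodicity \<Lambda> m n (proj_ob v)"
    show "local_periodicity (tilde \<Lambda>) m n v"
      unfolding local_periodicity_def
    proof (intro ballI impI)
      fix w assume w: "w \<in> boundary_paths (tilde \<Lambda>)" and wv: "pob w 0 = v"
      note w_inf = tilde_path_infinite[OF w]
      have "shift m w = shift n w"
      proof (rule bp_ext[OF shift_bp[OF w inf[OF w]] shift_bp[OF w inf[OF w]]])
        show "pdeg (shift m w) = pdeg (shift n w)"
          by (simp add: pdeg_shift w_inf to_edeg_def fun_eq_iff)
        fix a b :: "'k deg" assume ab: "a \<le> b"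
        \<comment> \<open>The sum serves as an upper bound of both endpoints.\<close>
        define l where "l = (m + b) + (n + b)"
        have rng: "pmor w (0, l) \<in> Mor (tilde \<Lambda>)" "rng (tilde \<Lambda>) (pmor w (0, l)) = v"
          "deg (tilde \<Lambda>) (pmor w (0, l)) = l"
          using wv by (simp_all add: bp_Mor[OF w] bp_rng[OF w] bp_deg[OF w] zero_le_deg inf[OF w])
        obtain x where x: "x \<in> boundary_paths \<Lambda>" "pob x 0 = proj_ob v"
          and ini: "pmor w (0, l) = P_class \<Lambda> x t (t + l)"
          using t_mor[OF rng(1,2)] rng(3) by auto
        have per: "P_class \<Lambda> x (t + (m + a)) (t + (m + b)) = P_class \<Lambda> x (t + (n + a)) (t + (n + b))"
          by (rule periodic_iff[OF x(1) t_zero[OF x], THEN iffD1, rule_format, OF _ ab])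
            (rule R[unfolded local_periodicity_def, rule_format, OF x])
        have le: "m + a \<le> m + b" "m + b \<le> l" "n + a \<le> n + b" "n + b \<le> l"
          using ab by (simp_all add: l_def le_fun_def)
        have "pmor w (m + a, m + b) = pmor w (n + a, n + b)"
          using tilde_path_segment[OF w x(1) ini le(1,2)] tilde_path_segment[OF w x(1) ini le(3,4)] per
          by simp
        then show "pmor (shift m w) (a, b) = pmor (shift n w) (a, b)"
          using ab inf[OF w] by (simp add: pmor_shift add.commute)
      qed
      then show "m - meet m (pdeg w) = n - meet n (pdeg w)
          \<and> shift (meet m (pdeg w)) w = shift (meet n (pdeg w)) w"
        by (simp add: w_inf meet_infinity fun_eq_iff)
    qed
  qed
qed

end

theorem proposition3p6:
  fixes \<Lambda> :: "('o, 'm, 'k::finite) graded_cat"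
  assumes "k_graph \<Lambda>" and "row_finite \<Lambda>" and "locally_convex \<Lambda>"
  shows "(\<forall>v \<in> Obj (tilde \<Lambda>). \<forall>m n. m \<noteq> n \<longrightarrow>
            (local_periodicity (tilde \<Lambda>) m n v \<longleftrightarrow> local_periodicity \<Lambda> m n (proj_ob v)))
         \<and> (no_local_periodicity (tilde \<Lambda>) \<longleftrightarrow> no_local_periodicity \<Lambda>)"
proof -
  interpret locally_convex_k_graph \<Lambda>
    using assms by (simp add: locally_convex_k_graph_def locally_convex_k_graph_axioms_def)
  have onto: "proj_ob ` Obj (tilde \<Lambda>) = Obj \<Lambda>"
  proof
    show "proj_ob ` Obj (tilde \<Lambda>) \<subseteq> Obj \<Lambda>"
      by (auto elim!: tilde_Obj_cases simp: proj_ob_class bp_Obj meet_le)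
    show "Obj \<Lambda> \<subseteq> proj_ob ` Obj (tilde \<Lambda>)"
    proof
      fix u assume "u \<in> Obj \<Lambda>"
      then obtain x where x: "x \<in> boundary_paths \<Lambda>" "pob x 0 = u" using boundary_path_exists by blast
      have "meet 0 (pdeg x) = 0" by (simp add: fun_eq_iff meet_apply split: enat.split)
      then have "proj_ob (V_class \<Lambda> x 0) = u" using x by (simp add: proj_ob_class)
      then show "u \<in> proj_ob ` Obj (tilde \<Lambda>)" using V_class_Obj[OF x(1)] by blast
    qed
  qed
  have "no_local_periodicity (tilde \<Lambda>) \<longleftrightarrow> no_local_periodicity \<Lambda>"
    by (simp add: no_local_periodicity_def local_periodicity_tilde_iff onto[symmetric] cong: bex_cong)
  then show ?thesis by (simp add: local_periodicity_tilde_iff)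
qed

end
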